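(* Let $R$ be a valuation ring which is not a field, with maximal ideal $P$, and let $F=E(R/Rr)$ for a nonzero $r\in P$. Then $R$ is almost maximal if and only if $F$ is uniserial.
   Context: All rings are commutative with unity and modules are unital. A module is uniserial if its submodules are linearly ordered by inclusion; a valuation ring is a ring that is uniserial as a module over itself. A valuation ring $R$ is almost maximal if every family of cosets $(a_i+L_i)_{i\in I}$ ($a_i\in R$, $L_i$ ideals) which is totally ordered by inclusion and satisfies $\bigcap_{i\in I}L_i\neq 0$ has nonempty intersection. $E(M)$ denotes the injective hull of an $R$-module $M$. Up to isomorphism $F=E(R/Rr)$ does not depend on the choice of nonzero $r\in P$ (known). *)

theory Defs
  imports "HOL-Algebra.Module" "HOL-Algebra.QuotRing"
begin

section \<open>Modules\<close>

definition module_hom ::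
    "('a, 'r) ring_scheme \<Rightarrow> ('a, 'b, 'm) module_scheme \<Rightarrow> ('a, 'c, 'n) module_scheme \<Rightarrow> ('b \<Rightarrow> 'c) set"
  where "module_hom R M N =
    {h \<in> carrier M \<rightarrow> carrier N.
      (\<forall>x\<in>carrier M. \<forall>y\<in>carrier M. h (x \<oplus>\<^bsub>M\<^esub> y) = h x \<oplus>\<^bsub>N\<^esub> h y) \<and>
      (\<forall>a\<in>carrier R. \<forall>x\<in>carrier M. h (a \<odot>\<^bsub>M\<^esub> x) = a \<odot>\<^bsub>N\<^esub> h x)}"

text \<open>The type of module records extends that of rings, but the locale \<^locale>\<open>module\<close> ignores
  the fields \<^const>\<open>monoid.mult\<close> and \<^const>\<open>one\<close> of a module; their values below are immaterial.\<close>

definition regular_module :: "('a, 'r) ring_scheme \<Rightarrow> ('a, 'a) module"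
  where "regular_module R =
    \<lparr>carrier = carrier R, monoid.mult = (\<otimes>\<^bsub>R\<^esub>), one = \<one>\<^bsub>R\<^esub>, ring.zero = \<zero>\<^bsub>R\<^esub>,
     add = (\<oplus>\<^bsub>R\<^esub>), smult = (\<otimes>\<^bsub>R\<^esub>)\<rparr>"

definition quotient_module :: "('a, 'r) ring_scheme \<Rightarrow> 'a set \<Rightarrow> ('a, 'a set) module"
  where "quotient_module R I =
    \<lparr>carrier = carrier (R Quot I), monoid.mult = (\<otimes>\<^bsub>R Quot I\<^esub>), one = \<one>\<^bsub>R Quot I\<^esub>,
     ring.zero = \<zero>\<^bsub>R Quot I\<^esub>, add = (\<oplus>\<^bsub>R Quot I\<^esub>),
     smult = (\<lambda>a x. (I +>\<^bsub>R\<^esub> a) \<otimes>\<^bsub>R Quot I\<^esub> x)\<rparr>"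

lemma (in cring) regular_module_module: "module R (regular_module R)"
proof (rule moduleI)
  show "abelian_group (regular_module R)"
    by (rule abelian_groupI)
       (auto simp: regular_module_def a_ac intro: l_neg)
qed (auto simp: regular_module_def l_distr r_distr m_assoc is_cring)

lemma (in cring) submodule_regular_module_iff:
  "submodule I R (regular_module R) \<longleftrightarrow> ideal I R"
proof
  interpret M: module R "regular_module R" by (rule regular_module_module)
  have minus: "\<ominus>\<^bsub>regular_module R\<^esub> x = \<ominus> x" for x
    by (simp add: a_inv_def m_inv_def regular_module_def)
  show "ideal I R" if "submodule I R (regular_module R)"
  proof -
    have "subgroup I (add_monoid R)"
      using submodule.axioms(1)[OF that] by (simp add: subgroup_def regular_module_def m_inv_def)
    moreover have "a \<otimes> x \<in> I" if "a \<in> carrier R" "x \<in> I" for a x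
      using submodule.smult_closed[OF \<open>submodule I R (regular_module R)\<close> that]
      by (simp add: regular_module_def)
    moreover have "a \<otimes> x \<in> I" if "a \<in> I" "x \<in> carrier R" for a x
    proof -
      have "a \<in> carrier R"
        using subgroup.mem_carrier[OF calculation(1) that(1)] by simp
      with calculation(2)[OF that(2,1)] that show ?thesis by (simp add: m_comm)
    qed
    ultimately show ?thesis
      by (intro idealI) (auto simp: ring_axioms)
  qed
  show "submodule I R (regular_module R)" if "ideal I R"
  proof -
    interpret ideal I R by fact
    show ?thesis
      by (rule M.submoduleI)
         (auto simp: minus, auto simp: regular_module_def I_l_closed)
  qed
qed

lemma (in cring) quotient_module_module:
  assumes "ideal I R"
  shows "module R (quotient_module R I)"
proof -
  interpret ideal I R by fact
  interpret Q: cring "R Quot I" by (rule quotient_is_cring) (rule is_cring)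
  have hom: "(+>) I \<in> ring_hom R (R Quot I)" by (rule rcos_ring_hom)
  note [simp] = ring_hom_closed[OF hom] ring_hom_add[OF hom] ring_hom_mult[OF hom] ring_hom_one[OF hom]
  show ?thesis
  proof (rule moduleI)
    show "abelian_group (quotient_module R I)"
      by (rule abelian_groupI)
         (auto simp: quotient_module_def Q.a_ac intro: Q.l_neg)
  qed (auto simp: quotient_module_def Q.l_distr Q.r_distr Q.m_assoc is_cring)
qed


section \<open>Uniserial modules and valuation rings\<close>

definition uniserial :: "('a, 'r) ring_scheme \<Rightarrow> ('a, 'b, 'm) module_scheme \<Rightarrow> bool"
  where "uniserial R M \<longleftrightarrow>
    module R M \<and> (\<forall>A B. submodule A R M \<longrightarrow> submodule B R M \<longrightarrow> A \<subseteq> B \<or> B \<subseteq> A)"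

definition valuation_ring :: "('a, 'r) ring_scheme \<Rightarrow> bool"
  where "valuation_ring R \<longleftrightarrow> cring R \<and> uniserial R (regular_module R)"

text \<open>A family of cosets $(a_i + L_i)_{i \in I}$ is given by the set \<open>K\<close> of the pairs
  $(a_i, L_i)$; whether the family is totally ordered, and what the two intersections are, depends
  on this set only. The intersections are taken inside the ring, which matters for the empty
  family only.\<close>

definition almost_maximal :: "('a, 'r) ring_scheme \<Rightarrow> bool"
  where "almost_maximal R \<longleftrightarrow> valuation_ring R \<and>
    (\<forall>K \<subseteq> carrier R \<times> {L. ideal L R}.
      (\<forall>(a, L)\<in>K. \<forall>(b, M)\<in>K. L +>\<^bsub>R\<^esub> a \<subseteq> M +>\<^bsub>R\<^esub> b \<or> M +>\<^bsub>R\<^esub> b \<subseteq> L +>\<^bsub>R\<^esub> a) \<and>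
      carrier R \<inter> (\<Inter>(a, L)\<in>K. L) \<noteq> {\<zero>\<^bsub>R\<^esub>}
      \<longrightarrow> carrier R \<inter> (\<Inter>(a, L)\<in>K. L +>\<^bsub>R\<^esub> a) \<noteq> {})"


section \<open>Injective modules and injective hulls\<close>

text \<open>The type argument bounds the universe of test modules: homomorphisms into \<open>E\<close> extend from
  submodules of all modules whose carrier lives in the type \<^typ>\<open>'c\<close>.\<close>

definition injective_wrt ::
    "'c itself \<Rightarrow> ('a, 'r) ring_scheme \<Rightarrow> ('a, 'b, 'm) module_scheme \<Rightarrow> bool"
  where "injective_wrt T R E \<longleftrightarrow> module R E \<and>
    (\<forall>(B :: ('a, 'c) module) A f.
      module R B \<and> submodule A R B \<and> f \<in> module_hom R (B\<lparr>carrier := A\<rparr>) E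
      \<longrightarrow> (\<exists>g \<in> module_hom R B E. \<forall>x\<in>A. g x = f x))"

text \<open>A HOL definition cannot quantify over all types \<^typ>\<open>'c\<close>. By Baer's criterion (see
  \<open>injective_module_imp_injective_wrt\<close> below) nothing is lost by letting the test modules live
  in the type of the ring: extension then holds for test modules in every type.\<close>

definition injective_module :: "('a, 'r) ring_scheme \<Rightarrow> ('a, 'b, 'm) module_scheme \<Rightarrow> bool"
  where "injective_module R E \<longleftrightarrow> injective_wrt TYPE('a) R E"

lemma injective_module_imp_injective_wrt:
  fixes R :: "('a, 'r) ring_scheme" and E :: "('a, 'b, 'm) module_scheme"
  assumes inj: "injective_module R E"
  shows "injective_wrt TYPE('c) R E"
  unfolding injective_wrt_def
proof (intro conjI allI impI, goal_cases)
  case 1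
  show E: ?case using inj by (simp add: injective_module_def injective_wrt_def)
  case (2 B A f)
  then have B: "module R B" and A: "submodule A R B"
    and f: "f \<in> module_hom R (B\<lparr>carrier := A\<rparr>) E" by auto
  interpret E: module R E by (rule E)
  interpret B: module R B by (rule B)
  note A' = B.submoduleE[OF A]
  have fD: "f x \<in> carrier E" "f (x \<oplus>\<^bsub>B\<^esub> y) = f x \<oplus>\<^bsub>E\<^esub> f y"
    "r \<in> carrier R \<Longrightarrow> f (r \<odot>\<^bsub>B\<^esub> x) = r \<odot>\<^bsub>E\<^esub> f x" if "x \<in> A" "y \<in> A" for x y r
    using f that by (auto simp: module_hom_def)
  have A0: "\<zero>\<^bsub>B\<^esub> \<in> A"
    using A'(1,2) A'(4)[OF E.R.zero_closed] by fastforce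
  have f0: "f \<zero>\<^bsub>B\<^esub> = \<zero>\<^bsub>E\<^esub>"
    using fD(3)[OF A0 A0 E.R.zero_closed] fD(1)[OF A0 A0] by simp
  \<comment> \<open>graphs of partial homomorphisms extending \<open>f\<close>\<close>
  define G where "G = {g. g \<subseteq> carrier B \<times> carrier E \<and> (\<lambda>x. (x, f x)) ` A \<subseteq> g \<and>
      (\<forall>x y x' y'. (x, y) \<in> g \<longrightarrow> (x', y') \<in> g \<longrightarrow> (x \<oplus>\<^bsub>B\<^esub> x', y \<oplus>\<^bsub>E\<^esub> y') \<in> g) \<and>
      (\<forall>r\<in>carrier R. \<forall>x y. (x, y) \<in> g \<longrightarrow> (r \<odot>\<^bsub>B\<^esub> x, r \<odot>\<^bsub>E\<^esub> y) \<in> g) \<and>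
      (\<forall>y. (\<zero>\<^bsub>B\<^esub>, y) \<in> g \<longrightarrow> y = \<zero>\<^bsub>E\<^esub>)}"
  have "\<exists>m\<in>G. \<forall>g\<in>G. m \<subseteq> g \<longrightarrow> g = m"
  proof (rule subset_Zorn_nonempty)
    have "(\<lambda>x. (x, f x)) ` A \<in> G"
      using A' f0 by (auto simp: G_def fD image_iff)
    then show "G \<noteq> {}" by blast
  next
    fix C assume "C \<noteq> {}" and C: "subset.chain G C"
    then have CG: "\<And>g. g \<in> C \<Longrightarrow> g \<in> G" and
      tot: "\<And>g h. g \<in> C \<Longrightarrow> h \<in> C \<Longrightarrow> g \<subseteq> h \<or> h \<subseteq> g"
      by (auto simp: subset_chain_def)
    show "\<Union>C \<in> G"
      unfolding G_def
    proof (intro CollectI conjI allI ballI impI, goal_cases)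
      case 1 show ?case using CG by (fastforce simp: G_def)
    next
      case 2
      obtain g where "g \<in> C" using \<open>C \<noteq> {}\<close> by blast
      with CG[of g] show ?case by (auto simp: G_def)
    next
      case (3 x y x' y')
      then obtain g h where gh: "(x, y) \<in> g" "(x', y') \<in> h" "g \<in> C" "h \<in> C" by blast
      with tot[of g h] obtain k where "k \<in> C" "(x, y) \<in> k" "(x', y') \<in> k" by blast
      moreover from this CG[of k] have "(x \<oplus>\<^bsub>B\<^esub> x', y \<oplus>\<^bsub>E\<^esub> y') \<in> k"
        unfolding G_def by blast
      ultimately show ?case by blast
    next
      case (4 r x y)
      then obtain g where "(x, y) \<in> g" "g \<in> C" by blast
      moreover from this CG[of g] 4 have "(r \<odot>\<^bsub>B\<^esub> x, r \<odot>\<^bsub>E\<^esub> y) \<in> g"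
        unfolding G_def by blast
      ultimately show ?case by blast
    next
      case (5 y)
      then obtain g where "(\<zero>\<^bsub>B\<^esub>, y) \<in> g" "g \<in> C" by blast
      with CG[of g] show ?case by (auto simp: G_def)
    qed
  qed
  then obtain m where mG: "m \<in> G" and max: "\<And>g. g \<in> G \<Longrightarrow> m \<subseteq> g \<Longrightarrow> g = m" by blast
  have m_carr: "x \<in> carrier B" "y \<in> carrier E" if "(x, y) \<in> m" for x y
    using mG that by (auto simp: G_def)
  have m_add: "(x \<oplus>\<^bsub>B\<^esub> x', y \<oplus>\<^bsub>E\<^esub> y') \<in> m" if "(x, y) \<in> m" "(x', y') \<in> m" for x y x' y'
    using mG that by (auto simp: G_def)
  have m_smult: "(r \<odot>\<^bsub>B\<^esub> x, r \<odot>\<^bsub>E\<^esub> y) \<in> m" if "(x, y) \<in> m" "r \<in> carrier R" for x y r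
    using mG that by (auto simp: G_def)
  have m_zero: "y = \<zero>\<^bsub>E\<^esub>" if "(\<zero>\<^bsub>B\<^esub>, y) \<in> m" for y
    using mG that by (auto simp: G_def)
  have m_f: "(x, f x) \<in> m" if "x \<in> A" for x
    using mG that by (auto simp: G_def)
  have m_minus: "(\<ominus>\<^bsub>B\<^esub> x, \<ominus>\<^bsub>E\<^esub> y) \<in> m" if "(x, y) \<in> m" for x y
    using m_smult[OF that, of "\<ominus>\<^bsub>R\<^esub> \<one>\<^bsub>R\<^esub>"] m_carr[OF that]
    by (simp add: B.smult_l_minus E.smult_l_minus)
  have m_fun: "y = y'" if "(x, y) \<in> m" "(x, y') \<in> m" for x y y'
  proof -
    have "(x \<oplus>\<^bsub>B\<^esub> \<ominus>\<^bsub>B\<^esub> x, y \<oplus>\<^bsub>E\<^esub> \<ominus>\<^bsub>E\<^esub> y') \<in> m"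
      by (rule m_add[OF that(1) m_minus[OF that(2)]])
    then have "y \<oplus>\<^bsub>E\<^esub> \<ominus>\<^bsub>E\<^esub> y' = \<zero>\<^bsub>E\<^esub>"
      using m_carr[OF that(1)] m_zero by (simp add: B.M.r_neg)
    then show ?thesis
      using m_carr[OF that(1)] m_carr[OF that(2)] E.M.minus_equality E.M.minus_minus
      by (metis E.M.a_inv_closed)
  qed
  have m00: "(\<zero>\<^bsub>B\<^esub>, \<zero>\<^bsub>E\<^esub>) \<in> m" using m_f[OF A0] f0 by simp
  have total: "\<exists>y. (b, y) \<in> m" if b: "b \<in> carrier B" for b
  proof -
    define I where "I = {r \<in> carrier R. \<exists>y. (r \<odot>\<^bsub>B\<^esub> b, y) \<in> m}"
    define h where "h r = (THE y. (r \<odot>\<^bsub>B\<^esub> b, y) \<in> m)" for r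
    have h_eq: "h r = y" if "(r \<odot>\<^bsub>B\<^esub> b, y) \<in> m" for r y
      unfolding h_def using that m_fun by (blast intro: the_equality)
    have h_m: "(r \<odot>\<^bsub>B\<^esub> b, h r) \<in> m" if "r \<in> I" for r
      using that h_eq by (auto simp: I_def)
    have hI_add: "((r \<oplus>\<^bsub>R\<^esub> s) \<odot>\<^bsub>B\<^esub> b, h r \<oplus>\<^bsub>E\<^esub> h s) \<in> m" if "r \<in> I" "s \<in> I" for r s
      using m_add[OF h_m[OF that(1)] h_m[OF that(2)]] that b by (simp add: B.smult_l_distr I_def)
    have hI_smult: "((s \<otimes>\<^bsub>R\<^esub> r) \<odot>\<^bsub>B\<^esub> b, s \<odot>\<^bsub>E\<^esub> h r) \<in> m" if "r \<in> I" "s \<in> carrier R" for r s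
      using m_smult[OF h_m[OF that(1)] that(2)] that b by (simp add: B.smult_assoc1 I_def)
    interpret RM: module R "regular_module R" by (rule E.R.regular_module_module)
    have subI: "submodule I R (regular_module R)"
    proof (rule RM.submoduleI)
      show "I \<subseteq> carrier (regular_module R)" by (auto simp: I_def regular_module_def)
      show "\<zero>\<^bsub>regular_module R\<^esub> \<in> I" using b m00 by (auto simp: I_def regular_module_def)
      show add: "r \<oplus>\<^bsub>regular_module R\<^esub> s \<in> I" if "r \<in> I" "s \<in> I" for r s
        using hI_add[OF that] that by (auto simp: I_def regular_module_def)
      show smult: "s \<odot>\<^bsub>regular_module R\<^esub> r \<in> I" if "s \<in> carrier R" "r \<in> I" for r s
        using hI_smult[OF that(2,1)] that by (auto simp: I_def regular_module_def)
      show "\<ominus>\<^bsub>regular_module R\<^esub> r \<in> I" if "r \<in> I" for r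
      proof -
        have "\<ominus>\<^bsub>regular_module R\<^esub> r = \<ominus>\<^bsub>R\<^esub> r"
          by (simp add: a_inv_def m_inv_def regular_module_def)
        then show ?thesis
          using smult[OF _ that, of "\<ominus>\<^bsub>R\<^esub> \<one>\<^bsub>R\<^esub>"] that
          by (simp add: I_def regular_module_def E.R.l_minus)
      qed
    qed
    have "h \<in> module_hom R ((regular_module R)\<lparr>carrier := I\<rparr>) E"
      using hI_add hI_smult m_carr(2)[OF h_m] h_eq
      by (auto simp: module_hom_def regular_module_def)
    with inj subI RM.module_axioms obtain g where
      g: "g \<in> module_hom R (regular_module R) E" and gh: "\<And>r. r \<in> I \<Longrightarrow> g r = h r"
      unfolding injective_module_def injective_wrt_def by metis
    define e where "e = g \<one>\<^bsub>R\<^esub>"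
    have e: "e \<in> carrier E" using g by (auto simp: e_def module_hom_def regular_module_def)
    have g_e: "g r = r \<odot>\<^bsub>E\<^esub> e" if "r \<in> carrier R" for r
    proof -
      have "g (r \<otimes>\<^bsub>R\<^esub> \<one>\<^bsub>R\<^esub>) = r \<odot>\<^bsub>E\<^esub> g \<one>\<^bsub>R\<^esub>"
        using g that E.R.one_closed unfolding module_hom_def regular_module_def by (simp del: E.R.r_one)
      then show ?thesis using that by (simp add: e_def)
    qed
    define m' where "m' = {(x \<oplus>\<^bsub>B\<^esub> r \<odot>\<^bsub>B\<^esub> b, y \<oplus>\<^bsub>E\<^esub> r \<odot>\<^bsub>E\<^esub> e) |x y r. (x, y) \<in> m \<and> r \<in> carrier R}"
    have m'I: "(x \<oplus>\<^bsub>B\<^esub> r \<odot>\<^bsub>B\<^esub> b, y \<oplus>\<^bsub>E\<^esub> r \<odot>\<^bsub>E\<^esub> e) \<in> m'" if "(x, y) \<in> m" "r \<in> carrier R" for x y r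
      using that by (auto simp: m'_def)
    have mm': "m \<subseteq> m'"
    proof (rule subrelI)
      fix x y assume "(x, y) \<in> m"
      from m'I[OF this E.R.zero_closed] m_carr[OF this] b e show "(x, y) \<in> m'" by simp
    qed
    have "m' \<in> G"
      unfolding G_def
    proof (intro CollectI conjI allI ballI impI, goal_cases)
      case 1 show ?case using m_carr b e by (auto simp: m'_def)
    next
      case 2 show ?case using m_f mm' by blast
    next
      case (3 u v u' v')
      then obtain x y r x' y' r' where *: "(x, y) \<in> m" "r \<in> carrier R" "(x', y') \<in> m" "r' \<in> carrier R"
        "u = x \<oplus>\<^bsub>B\<^esub> r \<odot>\<^bsub>B\<^esub> b" "v = y \<oplus>\<^bsub>E\<^esub> r \<odot>\<^bsub>E\<^esub> e"
        "u' = x' \<oplus>\<^bsub>B\<^esub> r' \<odot>\<^bsub>B\<^esub> b" "v' = y' \<oplus>\<^bsub>E\<^esub> r' \<odot>\<^bsub>E\<^esub> e"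
        unfolding m'_def by blast
      have "u \<oplus>\<^bsub>B\<^esub> u' = (x \<oplus>\<^bsub>B\<^esub> x') \<oplus>\<^bsub>B\<^esub> (r \<oplus>\<^bsub>R\<^esub> r') \<odot>\<^bsub>B\<^esub> b"
        "v \<oplus>\<^bsub>E\<^esub> v' = (y \<oplus>\<^bsub>E\<^esub> y') \<oplus>\<^bsub>E\<^esub> (r \<oplus>\<^bsub>R\<^esub> r') \<odot>\<^bsub>E\<^esub> e"
        using * m_carr[OF *(1)] m_carr[OF *(3)] b e
        by (simp_all add: B.smult_l_distr E.smult_l_distr B.M.a_ac E.M.a_ac)
      then show ?case using m'I[OF m_add[OF *(1,3)], of "r \<oplus>\<^bsub>R\<^esub> r'"] * by simp
    next
      case (4 s u v)
      then obtain x y r where *: "(x, y) \<in> m" "r \<in> carrier R"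
        "u = x \<oplus>\<^bsub>B\<^esub> r \<odot>\<^bsub>B\<^esub> b" "v = y \<oplus>\<^bsub>E\<^esub> r \<odot>\<^bsub>E\<^esub> e"
        unfolding m'_def by blast
      have "s \<odot>\<^bsub>B\<^esub> u = s \<odot>\<^bsub>B\<^esub> x \<oplus>\<^bsub>B\<^esub> (s \<otimes>\<^bsub>R\<^esub> r) \<odot>\<^bsub>B\<^esub> b"
        "s \<odot>\<^bsub>E\<^esub> v = s \<odot>\<^bsub>E\<^esub> y \<oplus>\<^bsub>E\<^esub> (s \<otimes>\<^bsub>R\<^esub> r) \<odot>\<^bsub>E\<^esub> e"
        using * m_carr[OF *(1)] b e 4
        by (simp_all add: B.smult_r_distr E.smult_r_distr B.smult_assoc1 E.smult_assoc1)
      then show ?case using m'I[OF m_smult[OF *(1)], of s "s \<otimes>\<^bsub>R\<^esub> r"] * 4 by simp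
    next
      case (5 v)
      then obtain x y r where *: "(x, y) \<in> m" "r \<in> carrier R"
        "\<zero>\<^bsub>B\<^esub> = x \<oplus>\<^bsub>B\<^esub> r \<odot>\<^bsub>B\<^esub> b" "v = y \<oplus>\<^bsub>E\<^esub> r \<odot>\<^bsub>E\<^esub> e"
        unfolding m'_def by blast
      have c: "x \<in> carrier B" "y \<in> carrier E" "r \<odot>\<^bsub>B\<^esub> b \<in> carrier B"
        using m_carr[OF *(1)] * b by auto
      have "\<ominus>\<^bsub>B\<^esub> x = r \<odot>\<^bsub>B\<^esub> b"
        using *(3) c B.M.minus_equality[of "r \<odot>\<^bsub>B\<^esub> b" x] by (simp add: B.M.a_comm)
      with m_minus[OF *(1)] have rb: "(r \<odot>\<^bsub>B\<^esub> b, \<ominus>\<^bsub>E\<^esub> y) \<in> m" by simp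
      then have "r \<in> I" using * by (auto simp: I_def)
      with gh[of r] g_e[of r] h_eq[OF rb] *(2) have "r \<odot>\<^bsub>E\<^esub> e = \<ominus>\<^bsub>E\<^esub> y" by simp
      then show ?case using * c by (simp add: E.M.r_neg)
    qed
    with max mm' have "m' = m" by blast
    with m'I[OF m00 E.R.one_closed] b show ?thesis by auto
  qed
  define g where "g x = (THE y. (x, y) \<in> m)" for x
  have g_eq: "g x = y" if "(x, y) \<in> m" for x y
    unfolding g_def using that m_fun by (blast intro: the_equality)
  have g_m: "(x, g x) \<in> m" if "x \<in> carrier B" for x
    using total[OF that] g_eq by auto
  have "g \<in> module_hom R B E"
    using g_m m_carr(2)[OF g_m] m_add m_smult by (auto simp: module_hom_def intro!: g_eq)
  moreover have "\<forall>x\<in>A. g x = f x" using m_f g_eq by blast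
  ultimately show ?case by blast
qed

text \<open>\<open>E\<close> together with the embedding \<open>j\<close> is an injective hull of \<open>M\<close>: an injective essential
  extension.\<close>

definition injective_hull ::
    "('a, 'r) ring_scheme \<Rightarrow> ('a, 'b, 'm) module_scheme \<Rightarrow> ('a, 'c, 'n) module_scheme \<Rightarrow> ('b \<Rightarrow> 'c) \<Rightarrow> bool"
  where "injective_hull R M E j \<longleftrightarrow>
    module R M \<and> injective_module R E \<and>
    j \<in> module_hom R M E \<and> inj_on j (carrier M) \<and>
    (\<forall>N. submodule N R E \<and> N \<noteq> {\<zero>\<^bsub>E\<^esub>} \<longrightarrow> N \<inter> j ` carrier M \<noteq> {\<zero>\<^bsub>E\<^esub>})"

end

theory Submission
  imports Defs
begin

text \<open>The generator \<open>g\<close> of \<open>R/Rr \<subseteq> F\<close> has annihilator \<open>Rr\<close>, and by injectivity every nonzero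
  nonunit \<open>s\<close> generates the annihilator of some \<open>y \<in> F\<close>.

  If \<open>F\<close> is uniserial and $s \neq 0$ lies in all the ideals $L_i$ of a chain of cosets $a_i + L_i$,
  then multiplication by $a_i$ on $(Rs : L_i)$ gives a single homomorphism $x \mapsto x a_i y$ on
  $\bigcup_i (Rs : L_i)$, which extends to $x \mapsto x z$. Comparing \<open>z\<close> with \<open>y\<close> gives
  $z = c y$, whence $c - a_i$ lies in the double annihilator of $L_i$ modulo \<open>s\<close>; unless the chain
  has a least member, this suffices.

  If \<open>R\<close> is almost maximal and $\mathrm{ann}(x) \subseteq \mathrm{ann}(y)$ in \<open>F\<close>, then whenever
  \<open>d y \<in> R x\<close> even \<open>d y \<in> R d x\<close>. The solutions \<open>a\<close> of \<open>d y = d a x\<close> form a chain of cosets, and for a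
  common solution \<open>a\<close> the submodule generated by \<open>y - a x\<close> meets \<open>R x\<close> trivially, so \<open>y = a x\<close> as
  \<open>F\<close> is uniform. The intersection of the chain may be zero only if \<open>R\<close> has zero divisors, and then
  \<open>R\<close> is maximal.\<close>

section \<open>Cyclic submodules, uniseriality, and homomorphisms out of ideals\<close>

lemma (in module) submodule_cyclic:
  assumes x: "x \<in> carrier M"
  shows "submodule {a \<odot>\<^bsub>M\<^esub> x |a. a \<in> carrier R} R M"
proof (rule submoduleI)
  show "\<zero>\<^bsub>M\<^esub> \<in> {a \<odot>\<^bsub>M\<^esub> x |a. a \<in> carrier R}"
    using x by (intro CollectI exI[of _ "\<zero>\<^bsub>R\<^esub>"]) simp
  fix u v assume uv: "u \<in> {a \<odot>\<^bsub>M\<^esub> x |a. a \<in> carrier R}" "v \<in> {a \<odot>\<^bsub>M\<^esub> x |a. a \<in> carrier R}"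
  then obtain a b where ab: "a \<in> carrier R" "u = a \<odot>\<^bsub>M\<^esub> x" "b \<in> carrier R" "v = b \<odot>\<^bsub>M\<^esub> x" by blast
  then show "\<ominus>\<^bsub>M\<^esub> u \<in> {a \<odot>\<^bsub>M\<^esub> x |a. a \<in> carrier R}"
    using x by (intro CollectI exI[of _ "\<ominus>\<^bsub>R\<^esub> a"]) (simp add: smult_l_minus)
  show "u \<oplus>\<^bsub>M\<^esub> v \<in> {a \<odot>\<^bsub>M\<^esub> x |a. a \<in> carrier R}"
    using x ab by (intro CollectI exI[of _ "a \<oplus>\<^bsub>R\<^esub> b"]) (simp add: smult_l_distr)
next
  fix b u assume b: "b \<in> carrier R" and "u \<in> {a \<odot>\<^bsub>M\<^esub> x |a. a \<in> carrier R}"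
  then obtain a where "a \<in> carrier R" "u = a \<odot>\<^bsub>M\<^esub> x" by blast
  then show "b \<odot>\<^bsub>M\<^esub> u \<in> {a \<odot>\<^bsub>M\<^esub> x |a. a \<in> carrier R}"
    using x b by (intro CollectI exI[of _ "b \<otimes>\<^bsub>R\<^esub> a"]) (simp add: smult_assoc1)
qed (use x in auto)

text \<open>Two incomparable submodules would contain elements neither of which is a multiple of the
  other.\<close>

lemma (in module) uniserial_iff_cyclic:
  "uniserial R M \<longleftrightarrow> (\<forall>x\<in>carrier M. \<forall>y\<in>carrier M.
    (\<exists>a\<in>carrier R. y = a \<odot>\<^bsub>M\<^esub> x) \<or> (\<exists>a\<in>carrier R. x = a \<odot>\<^bsub>M\<^esub> y))"
proof
  have mem: "x \<in> {a \<odot>\<^bsub>M\<^esub> x |a. a \<in> carrier R}" if "x \<in> carrier M" for x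
    using that by (intro CollectI exI[of _ "\<one>\<^bsub>R\<^esub>"]) simp
  show "\<forall>x\<in>carrier M. \<forall>y\<in>carrier M.
    (\<exists>a\<in>carrier R. y = a \<odot>\<^bsub>M\<^esub> x) \<or> (\<exists>a\<in>carrier R. x = a \<odot>\<^bsub>M\<^esub> y)" if "uniserial R M"
  proof (intro ballI)
    fix x y assume "x \<in> carrier M" "y \<in> carrier M"
    with that submodule_cyclic have "{a \<odot>\<^bsub>M\<^esub> x |a. a \<in> carrier R} \<subseteq> {a \<odot>\<^bsub>M\<^esub> y |a. a \<in> carrier R}
      \<or> {a \<odot>\<^bsub>M\<^esub> y |a. a \<in> carrier R} \<subseteq> {a \<odot>\<^bsub>M\<^esub> x |a. a \<in> carrier R}"
      by (simp add: uniserial_def)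
    with mem[OF \<open>x \<in> carrier M\<close>] mem[OF \<open>y \<in> carrier M\<close>]
    show "(\<exists>a\<in>carrier R. y = a \<odot>\<^bsub>M\<^esub> x) \<or> (\<exists>a\<in>carrier R. x = a \<odot>\<^bsub>M\<^esub> y)" by blast
  qed
  show "uniserial R M" if *: "\<forall>x\<in>carrier M. \<forall>y\<in>carrier M.
    (\<exists>a\<in>carrier R. y = a \<odot>\<^bsub>M\<^esub> x) \<or> (\<exists>a\<in>carrier R. x = a \<odot>\<^bsub>M\<^esub> y)"
    unfolding uniserial_def
  proof (intro conjI allI impI module_axioms)
    fix A B assume A: "submodule A R M" and B: "submodule B R M"
    show "A \<subseteq> B \<or> B \<subseteq> A"
    proof (rule ccontr)
      assume "\<not> ?thesis"
      then obtain x y where "x \<in> A" "x \<notin> B" "y \<in> B" "y \<notin> A" by blast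
      moreover from this have "x \<in> carrier M" "y \<in> carrier M"
        using submoduleE(1)[OF A] submoduleE(1)[OF B] by auto
      ultimately show False
        using * submoduleE(4)[OF A] submoduleE(4)[OF B] by metis
    qed
  qed
qed

text \<open>An extension of \<open>f\<close> to all of \<open>R\<close> is determined by the image
  \<open>z\<close> of one. Only the values of \<open>f\<close> on \<open>J\<close> matter, so
  \<open>f\<close> may be given by a choice or a description that is meaningful on \<open>J\<close>
  alone.\<close>

lemma injective_module_extend_ideal:
  assumes inj: "injective_module R E" and J: "ideal J R"
    and closed: "\<And>x. x \<in> J \<Longrightarrow> f x \<in> carrier E"
    and add: "\<And>x y. x \<in> J \<Longrightarrow> y \<in> J \<Longrightarrow> f (x \<oplus>\<^bsub>R\<^esub> y) = f x \<oplus>\<^bsub>E\<^esub> f y"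
    and smult: "\<And>a x. a \<in> carrier R \<Longrightarrow> x \<in> J \<Longrightarrow> f (a \<otimes>\<^bsub>R\<^esub> x) = a \<odot>\<^bsub>E\<^esub> f x"
  shows "\<exists>z\<in>carrier E. \<forall>x\<in>J. f x = x \<odot>\<^bsub>E\<^esub> z"
proof -
  interpret E: module R E using inj by (simp add: injective_module_def injective_wrt_def)
  have "submodule J R (regular_module R)" using J E.R.submodule_regular_module_iff by simp
  moreover have "f \<in> module_hom R ((regular_module R)\<lparr>carrier := J\<rparr>) E"
    using closed add smult by (auto simp: module_hom_def regular_module_def)
  ultimately obtain g where g: "g \<in> module_hom R (regular_module R) E" and gf: "\<And>x. x \<in> J \<Longrightarrow> g x = f x"
    using inj E.R.regular_module_module unfolding injective_module_def injective_wrt_def by metis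
  have "g \<one>\<^bsub>R\<^esub> \<in> carrier E" using g by (auto simp: module_hom_def regular_module_def)
  moreover have "f x = x \<odot>\<^bsub>E\<^esub> g \<one>\<^bsub>R\<^esub>" if "x \<in> J" for x
  proof -
    have x: "x \<in> carrier R" using that ideal.Icarr[OF J] by blast
    then have "g (x \<otimes>\<^bsub>R\<^esub> \<one>\<^bsub>R\<^esub>) = x \<odot>\<^bsub>E\<^esub> g \<one>\<^bsub>R\<^esub>"
      using g E.R.one_closed unfolding module_hom_def regular_module_def by (simp del: E.R.r_one)
    with x gf[OF that] show ?thesis by simp
  qed
  ultimately show ?thesis by blast
qed

section \<open>Divisibility in valuation rings\<close>

locale valuation_cring = cring R for R (structure) +
  assumes divides_linear: "\<lbrakk>a \<in> carrier R; b \<in> carrier R\<rbrakk>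
    \<Longrightarrow> (\<exists>c\<in>carrier R. b = c \<otimes> a) \<or> (\<exists>c\<in>carrier R. a = c \<otimes> b)"

text \<open>Cyclic submodules of the regular module are the principal ideals, so uniseriality
  becomes linearity of divisibility.\<close>

lemma valuation_ring_imp_valuation_cring:
  assumes "valuation_ring R"
  shows "valuation_cring R"
proof -
  interpret cring R using assms by (simp add: valuation_ring_def)
  interpret RM: module R "regular_module R" by (rule regular_module_module)
  have "uniserial R (regular_module R)" using assms by (simp add: valuation_ring_def)
  then have "\<forall>x\<in>carrier R. \<forall>y\<in>carrier R.
      (\<exists>a\<in>carrier R. y = a \<otimes>\<^bsub>R\<^esub> x) \<or> (\<exists>a\<in>carrier R. x = a \<otimes>\<^bsub>R\<^esub> y)"
    unfolding RM.uniserial_iff_cyclic by (simp add: regular_module_def)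
  then show ?thesis by unfold_locales blast
qed

lemma (in ring) ideal_minus_closed:
  assumes "ideal L R" "x \<in> L" "y \<in> L"
  shows "x \<ominus> y \<in> L"
proof -
  interpret ideal L R by fact
  show ?thesis using assms(2,3) by (simp add: a_minus_def)
qed

context valuation_cring
begin

text \<open>If \<open>d\<close> were a multiple of \<open>x\<close>, it would lie in
  \<open>L\<close>; linearity of divisibility leaves the opposite.\<close>

lemma ideal_principal_cases:
  assumes "ideal L R" "d \<in> carrier R" "d \<notin> L" "x \<in> L"
  obtains c where "c \<in> carrier R" "x = c \<otimes> d"
proof -
  interpret ideal L R by fact
  from divides_linear[OF Icarr[OF assms(4)] assms(2)] show thesis
    using that assms I_l_closed by blast
qed

lemma ideals_linear:
  assumes "ideal L R" "ideal M R"
  shows "L \<subseteq> M \<or> M \<subseteq> L"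
proof (rule ccontr)
  assume "\<not> ?thesis"
  then obtain x y where xy: "x \<in> L" "x \<notin> M" "y \<in> M" "y \<notin> L" by blast
  interpret L: ideal L R by fact
  obtain c where "c \<in> carrier R" "y = c \<otimes> x"
    using ideal_principal_cases[OF assms(2) L.Icarr[OF xy(1)] xy(2,3)] .
  with xy L.I_l_closed show False by blast
qed

text \<open>A valuation ring is local. Writing \<open>1 = q + v p\<close>: if \<open>p\<close>
  divides \<open>q\<close>, then \<open>p\<close> divides one and is a unit, which is excluded; if
  \<open>q\<close> divides \<open>p\<close>, then \<open>q\<close> divides one.\<close>

lemma one_minus_mult_nonunit:
  assumes p: "p \<in> carrier R" "p \<notin> Units R" and v: "v \<in> carrier R"
  shows "\<one> \<ominus> v \<otimes> p \<in> Units R"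
proof -
  define q where "q = \<one> \<ominus> v \<otimes> p"
  have q: "q \<in> carrier R" using p v by (simp add: q_def)
  have one: "\<one> = q \<oplus> v \<otimes> p" using p v unfolding q_def by algebra
  from divides_linear[OF p(1) q] show ?thesis
  proof
    assume "\<exists>c\<in>carrier R. q = c \<otimes> p"
    then obtain c where c: "c \<in> carrier R" "q = c \<otimes> p" by blast
    have "(c \<oplus> v) \<otimes> p = \<one>" using one c p v by (simp add: l_distr)
    moreover have "p \<otimes> (c \<oplus> v) = \<one>" using calculation c p v by (simp add: m_comm)
    ultimately have "p \<in> Units R" using p c v by (auto simp: Units_def intro!: bexI[of _ "c \<oplus> v"])
    with p show ?thesis by blast
  next
    assume "\<exists>c\<in>carrier R. p = c \<otimes> q"
    then obtain c where c: "c \<in> carrier R" "p = c \<otimes> q" by blast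
    have "(\<one> \<oplus> v \<otimes> c) \<otimes> q = q \<oplus> v \<otimes> (c \<otimes> q)" using c q v by algebra
    then have *: "(\<one> \<oplus> v \<otimes> c) \<otimes> q = \<one>" using one c by simp
    moreover have "q \<otimes> (\<one> \<oplus> v \<otimes> c) = \<one>" using * c q v by (simp add: m_comm)
    ultimately have "q \<in> Units R"
      using q c(1) v by (auto simp: Units_def intro!: bexI[of _ "\<one> \<oplus> v \<otimes> c"])
    then show ?thesis unfolding q_def .
  qed
qed

text \<open>Here \<open>(1 - v p) u = 0\<close> with a unit as first factor. This stands in for
  cancellation, since \<open>R\<close> may have zero divisors: later contradictions exhibit a
  nonzero element as a nonunit multiple of itself.\<close>

lemma nonunit_mult_fixed_zero:
  assumes p: "p \<in> carrier R" "p \<notin> Units R" and "v \<in> carrier R" "u \<in> carrier R"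
    and u: "u = v \<otimes> p \<otimes> u"
  shows "u = \<zero>"
proof -
  have U: "\<one> \<ominus> v \<otimes> p \<in> Units R" using one_minus_mult_nonunit assms by blast
  have "(\<one> \<ominus> v \<otimes> p) \<otimes> u = u \<ominus> v \<otimes> p \<otimes> u" using assms(1,3,4) by algebra
  also have "\<dots> = \<zero>" using u assms(4) by (metis r_neg a_minus_def)
  finally have "(\<one> \<ominus> v \<otimes> p) \<otimes> u = (\<one> \<ominus> v \<otimes> p) \<otimes> \<zero>"
    using U Units_closed by (simp only: r_null)
  then show ?thesis using Units_l_cancel[OF U] assms(4) by blast
qed

section \<open>Totally ordered families of cosets and almost maximality\<close>

lemma coset_subset_iff:
  assumes L: "ideal L R" and M: "ideal M R" and ab: "a \<in> carrier R" "b \<in> carrier R"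
  shows "L +> a \<subseteq> M +> b \<longleftrightarrow> L \<subseteq> M \<and> a \<ominus> b \<in> M"
proof -
  interpret L: ideal L R by fact
  interpret M: ideal M R by fact
  have mem: "c \<in> N +> d \<longleftrightarrow> c \<ominus> d \<in> N" if "ideal N R" "c \<in> carrier R" "d \<in> carrier R" for c d N
  proof -
    interpret ideal N R by fact
    show ?thesis using a_rcos_module_minus[OF ring_axioms] that by simp
  qed
  show ?thesis
  proof safe
    fix l assume sub: "L +> a \<subseteq> M +> b"
    have "a \<in> L +> a" using mem[OF L ab(1) ab(1)] ab by (simp add: a_minus_def r_neg)
    with sub mem[OF M ab] show "a \<ominus> b \<in> M" by blast
    moreover assume l: "l \<in> L"
    have "l \<oplus> a \<ominus> a = l" using l ab L.Icarr by algebra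
    then have "l \<oplus> a \<in> L +> a" using mem[OF L _ ab(1)] l ab L.Icarr by simp
    with sub have "l \<oplus> a \<ominus> b \<in> M" using mem[OF M _ ab(2)] l ab L.Icarr by auto
    ultimately have "(l \<oplus> a \<ominus> b) \<ominus> (a \<ominus> b) \<in> M" using ideal_minus_closed[OF M] by blast
    moreover have "(l \<oplus> a \<ominus> b) \<ominus> (a \<ominus> b) = l" using L.Icarr[OF l] ab by algebra
    ultimately show "l \<in> M" by simp
  next
    fix c assume sub: "L \<subseteq> M" "a \<ominus> b \<in> M" and c: "c \<in> L +> a"
    have cR: "c \<in> carrier R" using a_r_coset_subset_G[OF L.a_subset ab(1)] c by blast
    have "c \<ominus> a \<in> M" using mem[OF L cR ab(1)] c sub by blast
    then have "(c \<ominus> a) \<oplus> (a \<ominus> b) \<in> M" using sub by (simp add: M.a_closed)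
    moreover have "(c \<ominus> a) \<oplus> (a \<ominus> b) = c \<ominus> b" using cR ab by algebra
    ultimately show "c \<in> M +> b" using mem[OF M cR ab(2)] by simp
  qed
qed

text \<open>By \<open>coset_subset_iff\<close> this is total ordering of the cosets by inclusion,
  stated through ideals and differences so that ring identities apply directly.\<close>

definition coset_chain :: "('a \<times> 'a set) set \<Rightarrow> bool"
  where "coset_chain K \<longleftrightarrow> K \<subseteq> carrier R \<times> {L. ideal L R} \<and>
    (\<forall>(a, L)\<in>K. \<forall>(b, M)\<in>K. L \<subseteq> M \<and> a \<ominus> b \<in> M \<or> M \<subseteq> L \<and> b \<ominus> a \<in> L)"

lemma coset_chainI:
  assumes "\<And>a L. (a, L) \<in> K \<Longrightarrow> a \<in> carrier R \<and> ideal L R"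
    and "\<And>a L b M. (a, L) \<in> K \<Longrightarrow> (b, M) \<in> K \<Longrightarrow>
      L \<subseteq> M \<and> a \<ominus> b \<in> M \<or> M \<subseteq> L \<and> b \<ominus> a \<in> L"
  shows "coset_chain K"
proof -
  have "K \<subseteq> carrier R \<times> {L. ideal L R}" using assms(1) by auto
  with assms(2) show ?thesis unfolding coset_chain_def by (simp add: split_beta)
qed

lemma coset_chainD:
  assumes "coset_chain K" "(a, L) \<in> K"
  shows "a \<in> carrier R" "ideal L R"
    and "(b, M) \<in> K \<Longrightarrow> L \<subseteq> M \<and> a \<ominus> b \<in> M \<or> M \<subseteq> L \<and> b \<ominus> a \<in> L"
  using assms unfolding coset_chain_def by (blast, blast, fast)

lemma coset_chain_strictD:
  assumes K: "coset_chain K" "(a, L) \<in> K" "(b, M) \<in> K" and sub: "\<not> L \<subseteq> M"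
  shows "b \<ominus> a \<in> L"
  using coset_chainD(3)[OF K] sub by blast

text \<open>Every ideal contains zero, so an intersection of ideals other than {0} holds some
  nonzero \<open>s\<close>; a common point of the cosets is a simultaneous solution of
  congruences.\<close>

lemma almost_maximal_iff:
  assumes "valuation_ring R"
  shows "almost_maximal R \<longleftrightarrow>
    (\<forall>K s. coset_chain K \<longrightarrow> s \<in> carrier R \<longrightarrow> s \<noteq> \<zero> \<longrightarrow> (\<forall>(a, L)\<in>K. s \<in> L) \<longrightarrow>
      (\<exists>c\<in>carrier R. \<forall>(a, L)\<in>K. c \<ominus> a \<in> L))" (is "_ = ?rhs")
proof -
  have chain: "(\<forall>(a, L)\<in>K. \<forall>(b, M)\<in>K. L +> a \<subseteq> M +> b \<or> M +> b \<subseteq> L +> a) \<longleftrightarrow> coset_chain K"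
    if "K \<subseteq> carrier R \<times> {L. ideal L R}" for K
  proof -
    have "L +> a \<subseteq> M +> b \<or> M +> b \<subseteq> L +> a \<longleftrightarrow> L \<subseteq> M \<and> a \<ominus> b \<in> M \<or> M \<subseteq> L \<and> b \<ominus> a \<in> L"
      if "(a, L) \<in> K" "(b, M) \<in> K" for a L b M
    proof -
      have "ideal L R" "ideal M R" "a \<in> carrier R" "b \<in> carrier R" using that \<open>K \<subseteq> _\<close> by auto
      then show ?thesis by (simp add: coset_subset_iff)
    qed
    with that show ?thesis unfolding coset_chain_def by (simp add: split_beta)
  qed
  have inter: "carrier R \<inter> (\<Inter>(a, L)\<in>K. L) \<noteq> {\<zero>} \<longleftrightarrow> (\<exists>s\<in>carrier R. s \<noteq> \<zero> \<and> (\<forall>(a, L)\<in>K. s \<in> L))"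
    if "K \<subseteq> carrier R \<times> {L. ideal L R}" for K
  proof -
    have "\<zero> \<in> L" if "(a, L) \<in> K" for a L
    proof -
      interpret ideal L R using that \<open>K \<subseteq> _\<close> by blast
      show ?thesis by simp
    qed
    then have "\<zero> \<in> carrier R \<inter> (\<Inter>(a, L)\<in>K. L)" by auto
    moreover have "X \<noteq> {\<zero>} \<longleftrightarrow> (\<exists>s\<in>X. s \<noteq> \<zero>)" if "\<zero> \<in> X" for X using that by blast
    ultimately have "carrier R \<inter> (\<Inter>(a, L)\<in>K. L) \<noteq> {\<zero>} \<longleftrightarrow>
      (\<exists>s\<in>carrier R \<inter> (\<Inter>(a, L)\<in>K. L). s \<noteq> \<zero>)" by metis
    then show ?thesis by auto
  qed
  have sol: "carrier R \<inter> (\<Inter>(a, L)\<in>K. L +> a) \<noteq> {} \<longleftrightarrow> (\<exists>c\<in>carrier R. \<forall>(a, L)\<in>K. c \<ominus> a \<in> L)"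
    if K: "K \<subseteq> carrier R \<times> {L. ideal L R}" for K
  proof -
    have "c \<in> L +> a \<longleftrightarrow> c \<ominus> a \<in> L" if "(a, L) \<in> K" "c \<in> carrier R" for a c L
    proof -
      interpret ideal L R using that K by blast
      show ?thesis using a_rcos_module_minus[OF ring_axioms] that K by blast
    qed
    then have "(\<forall>(a, L)\<in>K. c \<in> L +> a) \<longleftrightarrow> (\<forall>(a, L)\<in>K. c \<ominus> a \<in> L)" if "c \<in> carrier R" for c
      using that by (simp add: split_beta)
    moreover have "carrier R \<inter> (\<Inter>(a, L)\<in>K. L +> a) \<noteq> {} \<longleftrightarrow> (\<exists>c\<in>carrier R. \<forall>(a, L)\<in>K. c \<in> L +> a)"
      by (auto simp: split_beta)
    ultimately show ?thesis by simp
  qed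
  have "almost_maximal R \<longleftrightarrow> (\<forall>K \<subseteq> carrier R \<times> {L. ideal L R}.
      coset_chain K \<and> (\<exists>s\<in>carrier R. s \<noteq> \<zero> \<and> (\<forall>(a, L)\<in>K. s \<in> L))
      \<longrightarrow> (\<exists>c\<in>carrier R. \<forall>(a, L)\<in>K. c \<ominus> a \<in> L))"
    unfolding almost_maximal_def using assms by (simp add: chain inter sol cong: imp_cong)
  moreover have "K \<subseteq> carrier R \<times> {L. ideal L R}" if "coset_chain K" for K
    using that by (simp add: coset_chain_def)
  ultimately show ?thesis by meson
qed

lemma almost_maximal_solve:
  assumes "almost_maximal R" "coset_chain K" "s \<in> carrier R" "s \<noteq> \<zero>"
    and "\<And>a L. (a, L) \<in> K \<Longrightarrow> s \<in> L"
  obtains c where "c \<in> carrier R" "\<And>a L. (a, L) \<in> K \<Longrightarrow> c \<ominus> a \<in> L"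
proof -
  have "valuation_ring R" using assms(1) by (simp add: almost_maximal_def)
  moreover have "\<forall>(a, L)\<in>K. s \<in> L" using assms(5) by blast
  ultimately obtain c where "c \<in> carrier R" "\<forall>(a, L)\<in>K. c \<ominus> a \<in> L"
    using iffD1[OF almost_maximal_iff assms(1)] assms(2-4) by blast
  with that show thesis by blast
qed

text \<open>With zero divisors, almost maximality solves every chain, without a common nonzero
  element of the ideals. Either a fixed nonzero \<open>b\<close> with \<open>b b = 0\<close> lies in
  all ideals, or some \<open>L0\<close> misses \<open>b\<close>; then \<open>L0\<close> lies in
  \<open>R b\<close>, and division by \<open>b\<close> yields a chain whose ideals do share
  \<open>b\<close>.\<close>

lemma almost_maximal_solve_zero_divisors:
  assumes am: "almost_maximal R" and K: "coset_chain K"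
    and pq: "p \<in> carrier R" "q \<in> carrier R" "p \<noteq> \<zero>" "q \<noteq> \<zero>" "p \<otimes> q = \<zero>"
  obtains c where "c \<in> carrier R" "\<And>a L. (a, L) \<in> K \<Longrightarrow> c \<ominus> a \<in> L"
proof -
  \<comment> \<open>Cosets inside \<open>R b\<close> pull back along \<open>c \<mapsto> c b\<close> to cosets of ideals containing \<open>b\<close>.\<close>
  obtain b where b: "b \<in> carrier R" "b \<noteq> \<zero>" "b \<otimes> b = \<zero>"
  proof -
    \<comment> \<open>Whichever of \<open>p\<close> and \<open>q\<close> is a multiple of the other
      squares to zero, its square being a multiple of \<open>p q\<close>.\<close>
    consider t where "t \<in> carrier R" "q = t \<otimes> p" | t where "t \<in> carrier R" "p = t \<otimes> q"
      using divides_linear[OF pq(1,2)] by blast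
    then show thesis
    proof cases
      case 1
      have "q \<otimes> q = t \<otimes> (p \<otimes> q)" using 1 pq by (simp add: m_assoc)
      with pq 1 that[of q] show thesis by simp
    next
      case 2
      have "p \<otimes> p = t \<otimes> (p \<otimes> q)" using 2 pq m_ac by (metis m_closed)
      with pq 2 that[of p] show thesis by simp
    qed
  qed
  show thesis
  proof (cases "\<forall>(a, L)\<in>K. b \<in> L")
    case True
    with almost_maximal_solve[OF am K b(1,2)] that show thesis by blast
  next
    case False
    then obtain a0 L0 where K0: "(a0, L0) \<in> K" and bL0: "b \<notin> L0" by blast
    note a0 = coset_chainD(1)[OF K K0] and L0 = coset_chainD(2)[OF K K0]
    \<comment> \<open>Only members with ideal inside \<open>L0\<close> are kept, shifted by
      \<open>a0\<close>. The coefficient \<open>c\<close> of \<open>a - a0\<close> is not unique, as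
      \<open>b\<close> is a zero divisor, so all coefficients are included.\<close>
    define K' where "K' = {(c, {m \<in> carrier R. m \<otimes> b \<in> L}) |c a L.
      (a, L) \<in> K \<and> L \<subseteq> L0 \<and> c \<in> carrier R \<and> a \<ominus> a0 = c \<otimes> b}"
    have quot: "ideal {m \<in> carrier R. m \<otimes> b \<in> L} R" if "ideal L R" for L
    proof -
      interpret ideal L R by fact
      show ?thesis
      proof (rule idealI[OF ring_axioms])
        show "subgroup {m \<in> carrier R. m \<otimes> b \<in> L} (add_monoid R)"
        proof (rule add.subgroupI)
          show "{m \<in> carrier R. m \<otimes> b \<in> L} \<noteq> {}" using b by (auto intro!: exI[of _ \<zero>])
        qed (use b in \<open>auto simp: l_distr l_minus\<close>)
      next
        fix m x assume "m \<in> {m \<in> carrier R. m \<otimes> b \<in> L}" and x: "x \<in> carrier R"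
        then have m: "m \<in> carrier R" "m \<otimes> b \<in> L" by auto
        show "x \<otimes> m \<in> {m \<in> carrier R. m \<otimes> b \<in> L}"
          using m x b I_l_closed[OF m(2) x] by (simp add: m_assoc)
        then show "m \<otimes> x \<in> {m \<in> carrier R. m \<otimes> b \<in> L}" using m x by (simp add: m_comm)
      qed
    qed
    have "coset_chain K'"
    proof (rule coset_chainI)
      fix c M assume "(c, M) \<in> K'"
      then show "c \<in> carrier R \<and> ideal M R" using quot coset_chainD(2)[OF K] by (auto simp: K'_def)
    next
      fix c M c' M' assume "(c, M) \<in> K'" "(c', M') \<in> K'"
      then obtain a L a' L' where
        X: "M = {m \<in> carrier R. m \<otimes> b \<in> L}" "(a, L) \<in> K" "c \<in> carrier R" "a \<ominus> a0 = c \<otimes> b" and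
        Y: "M' = {m \<in> carrier R. m \<otimes> b \<in> L'}" "(a', L') \<in> K" "c' \<in> carrier R" "a' \<ominus> a0 = c' \<otimes> b"
        unfolding K'_def by blast
      have a: "a \<in> carrier R" "a' \<in> carrier R" using coset_chainD(1)[OF K] X Y by blast+
      have "(c \<ominus> c') \<otimes> b = (a \<ominus> a0) \<ominus> (a' \<ominus> a0)"
        unfolding X(4) Y(4) using X(3) Y(3) b(1) by algebra
      also have "\<dots> = a \<ominus> a'" using a a0 by algebra
      finally have 1: "(c \<ominus> c') \<otimes> b = a \<ominus> a'" .
      have "(c' \<ominus> c) \<otimes> b = (a' \<ominus> a0) \<ominus> (a \<ominus> a0)"
        unfolding X(4) Y(4) using X(3) Y(3) b(1) by algebra
      also have "\<dots> = a' \<ominus> a" using a a0 by algebra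
      finally have "(c' \<ominus> c) \<otimes> b = a' \<ominus> a" .
      with 1 coset_chainD(3)[OF K X(2) Y(2)] X Y
      show "M \<subseteq> M' \<and> c \<ominus> c' \<in> M' \<or> M' \<subseteq> M \<and> c' \<ominus> c \<in> M" by auto
    qed
    moreover have "b \<in> M" if cM: "(c, M) \<in> K'" for c M
    proof -
      obtain a L where L: "(a, L) \<in> K" "M = {m \<in> carrier R. m \<otimes> b \<in> L}"
        using cM unfolding K'_def by blast
      interpret ideal L R using coset_chainD(2)[OF K L(1)] .
      show ?thesis using b L by simp
    qed
    ultimately obtain c where c: "c \<in> carrier R" "\<And>a M. (a, M) \<in> K' \<Longrightarrow> c \<ominus> a \<in> M"
      using almost_maximal_solve[OF am _ b(1,2)] by metis
    show thesis
    proof (rule that)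
      show "a0 \<oplus> c \<otimes> b \<in> carrier R" using a0 b c by simp
      fix a L assume aL: "(a, L) \<in> K"
      note a = coset_chainD(1)[OF K aL] and L = coset_chainD(2)[OF K aL]
      have small: "(a0 \<oplus> c \<otimes> b) \<ominus> a \<in> L" if aL: "(a, L) \<in> K" and sub: "L \<subseteq> L0" and aL0: "a \<ominus> a0 \<in> L0" for a L
      proof -
        note a = coset_chainD(1)[OF K aL]
        obtain d where d: "d \<in> carrier R" "a \<ominus> a0 = d \<otimes> b"
          using ideal_principal_cases[OF L0 b(1) bL0 aL0] .
        then have "(d, {m \<in> carrier R. m \<otimes> b \<in> L}) \<in> K'" using aL sub by (auto simp: K'_def)
        with c(2) have "(c \<ominus> d) \<otimes> b \<in> L" by blast
        moreover have "(c \<ominus> d) \<otimes> b = c \<otimes> b \<ominus> (a \<ominus> a0)" using c(1) d b(1) by algebra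
        moreover have "c \<otimes> b \<ominus> (a \<ominus> a0) = (a0 \<oplus> c \<otimes> b) \<ominus> a" using c(1) a a0 b(1) by algebra
        ultimately show ?thesis by simp
      qed
      interpret L: ideal L R by (rule L)
      interpret L0: ideal L0 R by (rule L0)
      from coset_chainD(3)[OF K aL K0] show "(a0 \<oplus> c \<otimes> b) \<ominus> a \<in> L"
      proof
        assume "L \<subseteq> L0 \<and> a \<ominus> a0 \<in> L0"
        with small aL show ?thesis by blast
      next
        assume *: "L0 \<subseteq> L \<and> a0 \<ominus> a \<in> L"
        \<comment> \<open>The member \<open>(a0, L0)\<close> is itself covered by
          \<open>small\<close>, so the solution lies in its coset, which is contained in the coset
          of \<open>a\<close>.\<close>
        have "a0 \<ominus> a0 \<in> L0" using a0 by (simp add: a_minus_def r_neg)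
        with small[OF K0] * have "(a0 \<oplus> c \<otimes> b) \<ominus> a0 \<in> L" by blast
        with * have "((a0 \<oplus> c \<otimes> b) \<ominus> a0) \<oplus> (a0 \<ominus> a) \<in> L" by blast
        moreover have "((a0 \<oplus> c \<otimes> b) \<ominus> a0) \<oplus> (a0 \<ominus> a) = (a0 \<oplus> c \<otimes> b) \<ominus> a"
          using a0 a b(1) c(1) by algebra
        ultimately show ?thesis by simp
      qed
    qed
  qed
qed

section \<open>Strict divisibility and principal annihilators\<close>

text \<open>Linearity gives \<open>b = d a\<close>, and a unit \<open>d\<close> could be inverted.
  The nonunit quotient is what \<open>nonunit_mult_fixed_zero\<close> consumes.\<close>

lemma not_multiple_nonunitE:
  assumes ab: "a \<in> carrier R" "b \<in> carrier R" and "\<not> (\<exists>c\<in>carrier R. a = c \<otimes> b)"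
  obtains d where "d \<in> carrier R" "d \<notin> Units R" "b = d \<otimes> a"
proof -
  obtain d where d: "d \<in> carrier R" "b = d \<otimes> a" using divides_linear[OF ab] assms(3) by blast
  have "d \<notin> Units R"
  proof
    assume U: "d \<in> Units R"
    then have "a = inv d \<otimes> b" using d ab by (simp add: m_assoc[symmetric])
    with U assms(3) show False by blast
  qed
  with d that show thesis by blast
qed

text \<open>If \<open>r = t s\<close>, then \<open>y = t g\<close> works. If \<open>s = t r\<close>,
  injectivity provides \<open>y\<close> with \<open>t y = g\<close>, by extending the map
  \<open>a t \<mapsto> a g\<close> from \<open>R t\<close> to \<open>R\<close>.\<close>

lemma principal_annihilator_exists:
  assumes inj: "injective_module R E"
    and g: "g \<in> carrier E"
      "\<And>a. a \<in> carrier R \<Longrightarrow> a \<odot>\<^bsub>E\<^esub> g = \<zero>\<^bsub>E\<^esub> \<longleftrightarrow> (\<exists>c\<in>carrier R. a = c \<otimes> r)"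
    and r: "r \<in> carrier R" "r \<noteq> \<zero>" "r \<notin> Units R"
    and s: "s \<in> carrier R" "s \<noteq> \<zero>"
  obtains y where "y \<in> carrier E"
    "\<And>a. a \<in> carrier R \<Longrightarrow> a \<odot>\<^bsub>E\<^esub> y = \<zero>\<^bsub>E\<^esub> \<longleftrightarrow> (\<exists>c\<in>carrier R. a = c \<otimes> s)"
proof -
  interpret E: module R E using inj by (simp add: injective_module_def injective_wrt_def)
  consider t where "t \<in> carrier R" "r = t \<otimes> s" | t where "t \<in> carrier R" "s = t \<otimes> r"
    using divides_linear[OF s(1) r(1)] by blast
  then show thesis
  proof cases
    case (1 t)
    show thesis
    proof (rule that)
      show "t \<odot>\<^bsub>E\<^esub> g \<in> carrier E" using 1 g by simp
      fix a assume a: "a \<in> carrier R"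
      have "a \<odot>\<^bsub>E\<^esub> (t \<odot>\<^bsub>E\<^esub> g) = \<zero>\<^bsub>E\<^esub> \<longleftrightarrow> (\<exists>c\<in>carrier R. a \<otimes> t = c \<otimes> r)"
        using a 1 g by (simp add: E.smult_assoc1[symmetric])
      also have "\<dots> \<longleftrightarrow> (\<exists>c\<in>carrier R. a = c \<otimes> s)"
      proof
        assume "\<exists>c\<in>carrier R. a \<otimes> t = c \<otimes> r"
        then obtain c where c: "c \<in> carrier R" "a \<otimes> t = c \<otimes> r" by blast
        show "\<exists>c\<in>carrier R. a = c \<otimes> s"
        \<comment> \<open>Instead of cancelling \<open>t\<close>: if \<open>s = d a\<close> with a
          nonunit \<open>d\<close>, then \<open>r = t s = d (a t) = d c r\<close>, a nonunit
          multiple of itself.\<close>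
        proof (rule ccontr)
          assume "\<not> ?thesis"
          then obtain d where d: "d \<in> carrier R" "d \<notin> Units R" "s = d \<otimes> a"
            using not_multiple_nonunitE[OF a s(1)] by blast
          have "r = d \<otimes> (a \<otimes> t)" unfolding 1(2) d(3) using a d(1) 1(1) by algebra
          also have "\<dots> = c \<otimes> d \<otimes> r" unfolding c(2) using c(1) d(1) r(1) by algebra
          finally show False using nonunit_mult_fixed_zero[OF d(1,2) c(1) r(1)] r(2) by blast
        qed
      next
        assume "\<exists>c\<in>carrier R. a = c \<otimes> s"
        then obtain c where "c \<in> carrier R" "a = c \<otimes> s" by blast
        with 1 s show "\<exists>c\<in>carrier R. a \<otimes> t = c \<otimes> r"
          by (intro bexI[of _ c]) (simp_all add: m_ac)
      qed
      finally show "a \<odot>\<^bsub>E\<^esub> (t \<odot>\<^bsub>E\<^esub> g) = \<zero>\<^bsub>E\<^esub> \<longleftrightarrow> (\<exists>c\<in>carrier R. a = c \<otimes> s)" .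
    qed
  next
    case (2 t)
    \<comment> \<open>The map \<open>a t \<mapsto> a g\<close> is well defined because the
      annihilator of \<open>t\<close> lies in \<open>R r\<close>: an element of it dividing
      \<open>r\<close> would make \<open>s = t r\<close> vanish.\<close>
    have well: "a \<odot>\<^bsub>E\<^esub> g = b \<odot>\<^bsub>E\<^esub> g"
      if ab: "a \<in> carrier R" "b \<in> carrier R" and eq: "a \<otimes> t = b \<otimes> t" for a b
    proof -
      have ab': "a \<ominus> b \<in> carrier R" using ab by simp
      have "(a \<ominus> b) \<otimes> t = a \<otimes> t \<ominus> b \<otimes> t" using ab 2(1) by algebra
      also have "\<dots> = \<zero>" using eq ab 2(1) by (simp add: a_minus_def r_neg)
      finally have 0: "(a \<ominus> b) \<otimes> t = \<zero>" .
      have "\<exists>c\<in>carrier R. a \<ominus> b = c \<otimes> r"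
      proof (rule ccontr)
        assume "\<not> ?thesis"
        then obtain d where d: "d \<in> carrier R" "r = d \<otimes> (a \<ominus> b)"
          using not_multiple_nonunitE[OF ab' r(1)] by blast
        have "s = d \<otimes> ((a \<ominus> b) \<otimes> t)" unfolding 2(2) d(2) using d(1) 2(1) ab by algebra
        with 0 d(1) s(2) show False by simp
      qed
      then have 1: "(a \<ominus> b) \<odot>\<^bsub>E\<^esub> g = \<zero>\<^bsub>E\<^esub>" using g ab' by blast
      have "a = (a \<ominus> b) \<oplus> b" using ab by algebra
      then have "a \<odot>\<^bsub>E\<^esub> g = ((a \<ominus> b) \<oplus> b) \<odot>\<^bsub>E\<^esub> g" by simp
      also have "\<dots> = b \<odot>\<^bsub>E\<^esub> g" using ab ab' 1 g(1) by (simp add: E.smult_l_distr)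
      finally show ?thesis .
    qed
    define f where "f x = (SOME a. a \<in> carrier R \<and> x = a \<otimes> t) \<odot>\<^bsub>E\<^esub> g" for x
    have f: "f (a \<otimes> t) = a \<odot>\<^bsub>E\<^esub> g" if "a \<in> carrier R" for a
    proof -
      have "(SOME b. b \<in> carrier R \<and> a \<otimes> t = b \<otimes> t) \<in> carrier R \<and>
          a \<otimes> t = (SOME b. b \<in> carrier R \<and> a \<otimes> t = b \<otimes> t) \<otimes> t"
        by (rule someI[of _ a]) (simp add: that)
      then show ?thesis unfolding f_def using well that by metis
    qed
    have "\<exists>z\<in>carrier E. \<forall>x\<in>PIdl t. f x = x \<odot>\<^bsub>E\<^esub> z"
    proof (rule injective_module_extend_ideal[OF inj cgenideal_ideal[OF 2(1)]])
      fix x assume "x \<in> PIdl t"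
      then obtain a where a: "a \<in> carrier R" "x = a \<otimes> t" by (auto simp: cgenideal_def)
      then show "f x \<in> carrier E" using f g by simp
      show "f (b \<otimes> x) = b \<odot>\<^bsub>E\<^esub> f x" if b: "b \<in> carrier R" for b
        using a b f[of "b \<otimes> a"] f[of a] 2(1) g(1) by (simp add: m_assoc E.smult_assoc1)
      fix y assume "y \<in> PIdl t"
      then obtain b where b: "b \<in> carrier R" "y = b \<otimes> t" by (auto simp: cgenideal_def)
      then show "f (x \<oplus> y) = f x \<oplus>\<^bsub>E\<^esub> f y"
        using a f[of "a \<oplus> b"] f[of a] f[of b] 2(1) g(1) by (simp add: l_distr E.smult_l_distr)
    qed
    then obtain z where z: "z \<in> carrier E" "\<And>x. x \<in> PIdl t \<Longrightarrow> f x = x \<odot>\<^bsub>E\<^esub> z" by blast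
    have tz: "(a \<otimes> t) \<odot>\<^bsub>E\<^esub> z = a \<odot>\<^bsub>E\<^esub> g" if a: "a \<in> carrier R" for a
    proof -
      have "a \<otimes> t \<in> PIdl t" using a by (auto simp: cgenideal_def)
      with z(2) f[OF a] show ?thesis by simp
    qed
    show thesis
    proof (rule that[OF z(1)])
      fix a assume a: "a \<in> carrier R"
      show "a \<odot>\<^bsub>E\<^esub> z = \<zero>\<^bsub>E\<^esub> \<longleftrightarrow> (\<exists>c\<in>carrier R. a = c \<otimes> s)"
      proof
        assume 0: "a \<odot>\<^bsub>E\<^esub> z = \<zero>\<^bsub>E\<^esub>"
        \<comment> \<open>Otherwise \<open>g = t z\<close> would be zero, so \<open>r\<close> would
          divide one.\<close>
        have "\<not> (\<exists>b\<in>carrier R. t = b \<otimes> a)"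
        proof
          assume "\<exists>b\<in>carrier R. t = b \<otimes> a"
          then obtain b where b: "b \<in> carrier R" "t = b \<otimes> a" by blast
          have "\<one> \<odot>\<^bsub>E\<^esub> g = (b \<otimes> a) \<odot>\<^bsub>E\<^esub> z" using tz[of \<one>] 2(1) b by simp
          also have "\<dots> = \<zero>\<^bsub>E\<^esub>" using a b(1) 0 z(1) by (simp add: E.smult_assoc1)
          finally obtain c where c: "c \<in> carrier R" "c \<otimes> r = \<one>" using g(2)[OF one_closed] by auto
          then have "r \<otimes> c = \<one>" using r(1) by (simp add: m_comm)
          with c r(1) have "r \<in> Units R" by (auto simp: Units_def)
          with r(3) show False by blast
        qed
        then obtain b where b: "b \<in> carrier R" "a = b \<otimes> t"
          using not_multiple_nonunitE[OF 2(1) a] by blast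
        then have "b \<odot>\<^bsub>E\<^esub> g = \<zero>\<^bsub>E\<^esub>" using tz 0 by simp
        then obtain c where "c \<in> carrier R" "b = c \<otimes> r" using g(2) b by blast
        with b 2 r(1) show "\<exists>c\<in>carrier R. a = c \<otimes> s"
          by (intro bexI[of _ c]) (simp_all add: m_ac)
      next
        assume "\<exists>c\<in>carrier R. a = c \<otimes> s"
        then obtain c where c: "c \<in> carrier R" "a = c \<otimes> s" by blast
        then have "a = (c \<otimes> r) \<otimes> t" using 2 r(1) by (simp add: m_ac)
        then have "a \<odot>\<^bsub>E\<^esub> z = (c \<otimes> r) \<odot>\<^bsub>E\<^esub> g" using tz c(1) r(1) by simp
        also have "\<dots> = \<zero>\<^bsub>E\<^esub>" using g(2) c(1) r(1) by blast
        finally show "a \<odot>\<^bsub>E\<^esub> z = \<zero>\<^bsub>E\<^esub>" .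
      qed
    qed
  qed
qed

section \<open>From a uniserial injective module to solutions of chains of cosets\<close>

text \<open>A chain with a least ideal is solved by the representative of that member. Otherwise
  each ideal strictly contains another one, and this slack absorbs the passage from an ideal to its
  double annihilator modulo \<open>s\<close>.\<close>

lemma uniserial_injective_solve:
  assumes inj: "injective_module R E" and uni: "uniserial R E"
    and g: "g \<in> carrier E"
      "\<And>a. a \<in> carrier R \<Longrightarrow> a \<odot>\<^bsub>E\<^esub> g = \<zero>\<^bsub>E\<^esub> \<longleftrightarrow> (\<exists>c\<in>carrier R. a = c \<otimes> r)"
    and r: "r \<in> carrier R" "r \<noteq> \<zero>" "r \<notin> Units R"
    and K: "coset_chain K" and s: "s \<in> carrier R" "s \<noteq> \<zero>" "\<And>a L. (a, L) \<in> K \<Longrightarrow> s \<in> L"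
  shows "\<exists>c\<in>carrier R. \<forall>(a, L)\<in>K. c \<ominus> a \<in> L"
proof (cases "\<exists>(a, L)\<in>K. \<forall>(b, M)\<in>K. L \<subseteq> M")
  case True
  then obtain a L where aL: "(a, L) \<in> K" and least: "\<And>b M. (b, M) \<in> K \<Longrightarrow> L \<subseteq> M" by blast
  have "a \<ominus> b \<in> M" if bM: "(b, M) \<in> K" for b M
  proof -
    note ab = coset_chainD(1)[OF K aL] coset_chainD(1)[OF K bM]
    interpret L: ideal L R using coset_chainD(2)[OF K aL] .
    \<comment> \<open>In the second alternative of the chain condition the two ideals coincide and
      only the sign differs.\<close>
    have "a \<ominus> b = \<ominus> (b \<ominus> a)" using ab by algebra
    with coset_chainD(3)[OF K aL bM] least[OF bM] show ?thesis by (metis L.a_inv_closed subset_antisym)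
  qed
  with coset_chainD(1)[OF K aL] show ?thesis by blast
next
  case False
  then have smaller: "\<exists>b M. (b, M) \<in> K \<and> \<not> L \<subseteq> M" if "(a, L) \<in> K" for a L
    using that by blast
  interpret E: module R E using inj by (simp add: injective_module_def injective_wrt_def)
  obtain y where y: "y \<in> carrier E"
    "\<And>a. a \<in> carrier R \<Longrightarrow> a \<odot>\<^bsub>E\<^esub> y = \<zero>\<^bsub>E\<^esub> \<longleftrightarrow> (\<exists>c\<in>carrier R. a = c \<otimes> s)"
    using principal_annihilator_exists[OF inj g r s(1,2)] by metis
  have y_PIdl: "a \<odot>\<^bsub>E\<^esub> y = \<zero>\<^bsub>E\<^esub> \<longleftrightarrow> a \<in> PIdl s" if "a \<in> carrier R" for a
    using y(2)[OF that] unfolding cgenideal_def by blast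
  define Q where "Q L = {x \<in> carrier R. \<forall>l\<in>L. x \<otimes> l \<in> PIdl s}" for L
  interpret S: ideal "PIdl s" R using cgenideal_ideal[OF s(1)] .
  \<comment> \<open>\<open>Q L\<close> is the ideal quotient \<open>(R s : L)\<close>.\<close>
  have QE: "\<exists>u\<in>Q L. s = u \<otimes> e" if L: "(a, L) \<in> K" and e: "e \<in> carrier R" "e \<notin> L" for a L e
  proof -
    note L' = coset_chainD(2)[OF K L]
    obtain u where u: "u \<in> carrier R" "s = u \<otimes> e"
      using ideal_principal_cases[OF L' e s(3)[OF L]] .
    have "u \<otimes> l \<in> PIdl s" if l: "l \<in> L" for l
    proof -
      obtain c where c: "c \<in> carrier R" "l = c \<otimes> e"
        using ideal_principal_cases[OF L' e l] .
      have "u \<otimes> l = c \<otimes> s" unfolding c(2) u(2) using c(1) u(1) e(1) by algebra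
      with c(1) show ?thesis unfolding cgenideal_def by blast
    qed
    with u(1) have "u \<in> Q L" unfolding Q_def by blast
    with u(2) show ?thesis by blast
  qed
  have Q_mono: "x \<in> Q L" if "x \<in> Q M" "L \<subseteq> M" for x L M using that by (auto simp: Q_def)
  have Q_add: "x \<oplus> x' \<in> Q L" if L: "(a, L) \<in> K" and x: "x \<in> Q L" "x' \<in> Q L" for a L x x'
    using x ideal.Icarr[OF coset_chainD(2)[OF K L]] by (auto simp: Q_def l_distr)
  have Q_mult: "b \<otimes> x \<in> Q L" if L: "(a, L) \<in> K" and x: "x \<in> Q L" "b \<in> carrier R" for a L x b
    using x ideal.Icarr[OF coset_chainD(2)[OF K L]] by (auto simp: Q_def m_assoc S.I_l_closed)
  \<comment> \<open>Changing \<open>a\<close> modulo \<open>L\<close> changes \<open>x a\<close> by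
    an element of \<open>R s\<close>, the annihilator of \<open>y\<close>.\<close>
  have smult_y_eq: "(x \<otimes> a) \<odot>\<^bsub>E\<^esub> y = (x \<otimes> b) \<odot>\<^bsub>E\<^esub> y"
    if x: "x \<in> Q L" and L: "a \<ominus> b \<in> L" and ab: "a \<in> carrier R" "b \<in> carrier R" for a b x L
  proof -
    have xR: "x \<in> carrier R" using x by (simp add: Q_def)
    have "x \<otimes> (a \<ominus> b) \<in> PIdl s" using x L by (simp add: Q_def)
    then have 0: "(x \<otimes> (a \<ominus> b)) \<odot>\<^bsub>E\<^esub> y = \<zero>\<^bsub>E\<^esub>"
      using y_PIdl[of "x \<otimes> (a \<ominus> b)"] xR ab by simp
    have "x \<otimes> a = x \<otimes> (a \<ominus> b) \<oplus> x \<otimes> b" using xR ab by algebra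
    then show ?thesis using 0 xR ab y(1) by (simp add: E.smult_l_distr)
  qed
  define J where "J = (\<Union>(a, L)\<in>K. Q L)"
  \<comment> \<open>An \<open>x\<close> may lie in several \<open>Q L\<close>; by the chain
    condition and \<open>smult_y_eq\<close> all of them give the same value.\<close>
  define f where "f x = (THE w. \<exists>(a, L)\<in>K. x \<in> Q L \<and> w = (x \<otimes> a) \<odot>\<^bsub>E\<^esub> y)" for x
  have f: "f x = (x \<otimes> a) \<odot>\<^bsub>E\<^esub> y" if aL: "(a, L) \<in> K" and x: "x \<in> Q L" for x a L
    unfolding f_def
  proof (rule the_equality)
    show "\<exists>(b, M)\<in>K. x \<in> Q M \<and> (x \<otimes> a) \<odot>\<^bsub>E\<^esub> y = (x \<otimes> b) \<odot>\<^bsub>E\<^esub> y" using aL x by blast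
    fix w assume "\<exists>(a, L)\<in>K. x \<in> Q L \<and> w = (x \<otimes> a) \<odot>\<^bsub>E\<^esub> y"
    then obtain b M where bM: "(b, M) \<in> K" "x \<in> Q M" "w = (x \<otimes> b) \<odot>\<^bsub>E\<^esub> y" by blast
    note ab = coset_chainD(1)[OF K aL] coset_chainD(1)[OF K bM(1)]
    from coset_chainD(3)[OF K aL bM(1)] show "w = (x \<otimes> a) \<odot>\<^bsub>E\<^esub> y"
      using smult_y_eq[OF bM(2) _ ab] smult_y_eq[OF x _ ab(2,1)] bM(3) by auto
  qed
  \<comment> \<open>\<open>Q L\<close> grows as \<open>L\<close> shrinks, so \<open>J\<close> is a
    directed union, closed under addition.\<close>
  have common: "\<exists>a L. (a, L) \<in> K \<and> x \<in> Q L \<and> x' \<in> Q L" if "x \<in> J" "x' \<in> J" for x x'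
  proof -
    obtain a L b M where *: "(a, L) \<in> K" "x \<in> Q L" "(b, M) \<in> K" "x' \<in> Q M"
      using \<open>x \<in> J\<close> \<open>x' \<in> J\<close> unfolding J_def by blast
    from ideals_linear[OF coset_chainD(2)[OF K *(1)] coset_chainD(2)[OF K *(3)]] show ?thesis
      using * Q_mono by blast
  qed
  have JR: "J \<subseteq> carrier R" by (auto simp: J_def Q_def)
  have J_add: "x \<oplus> x' \<in> J \<and> f (x \<oplus> x') = f x \<oplus>\<^bsub>E\<^esub> f x'" if xx': "x \<in> J" "x' \<in> J" for x x'
  proof -
    obtain a L where aL: "(a, L) \<in> K" "x \<in> Q L" "x' \<in> Q L" using common[OF xx'] by blast
    have "x \<in> carrier R" "x' \<in> carrier R" using xx' JR by auto
    with aL f[OF aL(1)] Q_add[OF aL] coset_chainD(1)[OF K aL(1)] y(1) show ?thesis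
      by (auto simp: J_def l_distr E.smult_l_distr)
  qed
  have J_mult: "b \<otimes> x \<in> J \<and> f (b \<otimes> x) = b \<odot>\<^bsub>E\<^esub> f x" if x: "x \<in> J" and b: "b \<in> carrier R" for x b
  proof -
    obtain a L where aL: "(a, L) \<in> K" "x \<in> Q L" using x unfolding J_def by blast
    have "x \<in> carrier R" using x JR by auto
    with aL f[OF aL(1)] Q_mult[OF aL b] b coset_chainD(1)[OF K aL(1)] y(1) show ?thesis
      by (auto simp: J_def m_assoc E.smult_assoc1)
  qed
  show ?thesis
  \<comment> \<open>For empty \<open>K\<close> the union \<open>J\<close> would be empty and no
    ideal.\<close>
  proof (cases "K = {}")
    case True
    then show ?thesis by blast
  next
    case nonempty: False
    then obtain a0 L0 where K0: "(a0, L0) \<in> K" by auto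
    \<comment> \<open>Two descents are made: not containing \<open>L0\<close>, the ideal
      \<open>L1\<close> is proper, so \<open>e\<close> in \<open>L1\<close> is a nonunit; lying
      outside \<open>L2\<close>, it gives \<open>s = u e\<close> with \<open>u\<close> in
      \<open>Q L2\<close>.\<close>
    from smaller[OF K0] obtain a1 L1 where K1: "(a1, L1) \<in> K" "\<not> L0 \<subseteq> L1" by blast
    from smaller[OF K1(1)] obtain a2 L2 where K2: "(a2, L2) \<in> K" "\<not> L1 \<subseteq> L2" by blast
    obtain e where e: "e \<in> L1" "e \<notin> L2" using K2 by blast
    interpret L1: ideal L1 R using coset_chainD(2)[OF K K1(1)] .
    have "ideal J R"
    proof (rule idealI[OF ring_axioms])
      show "subgroup J (add_monoid R)"
      proof (rule add.subgroupI)
        have "s \<otimes> l \<in> PIdl s" if l: "l \<in> L1" for l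
          by (rule S.I_r_closed[OF cgenideal_self[OF s(1)] L1.Icarr[OF l]])
        then have "s \<in> Q L1" using s(1) by (simp add: Q_def)
        with K1(1) show "J \<noteq> {}" unfolding J_def by blast
        show "\<ominus> x \<in> J" if x: "x \<in> J" for x
        proof -
          have "x \<in> carrier R" by (rule subsetD[OF JR x])
          with J_mult[OF x, of "\<ominus> \<one>"] show ?thesis by (simp add: l_minus)
        qed
      qed (use JR J_add in auto)
    next
      fix x b assume xb: "x \<in> J" "b \<in> carrier R"
      with J_mult show "b \<otimes> x \<in> J" by blast
      moreover have "x \<in> carrier R" by (rule subsetD[OF JR xb(1)])
      ultimately show "x \<otimes> b \<in> J" using xb by (simp add: m_comm)
    qed
    moreover have "f x \<in> carrier E" if x: "x \<in> J" for x
    proof -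
      obtain a L where aL: "(a, L) \<in> K" "x \<in> Q L" using x unfolding J_def by blast
      with f[OF aL] coset_chainD(1)[OF K aL(1)] y(1) subsetD[OF JR x] show ?thesis by simp
    qed
    ultimately obtain z where z: "z \<in> carrier E" "\<And>x. x \<in> J \<Longrightarrow> f x = x \<odot>\<^bsub>E\<^esub> z"
      using injective_module_extend_ideal[OF inj, of J f] J_add J_mult by blast
    have z_eq: "(x \<otimes> a) \<odot>\<^bsub>E\<^esub> y = x \<odot>\<^bsub>E\<^esub> z" if aL: "(a, L) \<in> K" "x \<in> Q L" for a L x
      using z(2)[of x] f[OF aL] aL by (auto simp: J_def)
    \<comment> \<open>Otherwise \<open>y = b z\<close> with a nonunit \<open>b\<close>. Then
      \<open>u y = b u z = b a2 u y\<close>, and as \<open>1 - a2 b\<close> is a unit,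
      \<open>u\<close> is a multiple of \<open>s = u e\<close> with \<open>e\<close> a nonunit.
      Hence \<open>u\<close> and \<open>s\<close> are zero.\<close>
    have "\<exists>c\<in>carrier R. z = c \<odot>\<^bsub>E\<^esub> y"
    proof (rule ccontr)
      assume no: "\<not> ?thesis"
      then obtain b where b: "b \<in> carrier R" "y = b \<odot>\<^bsub>E\<^esub> z"
        using uni y(1) z(1) unfolding E.uniserial_iff_cyclic by blast
      have bU: "b \<notin> Units R"
      proof
        assume U: "b \<in> Units R"
        then have "inv b \<odot>\<^bsub>E\<^esub> y = z" using b z(1) by (simp add: E.smult_assoc1[symmetric])
        with no Units_inv_closed[OF U] show False by blast
      qed
      note a2 = coset_chainD(1)[OF K K2(1)]
      have eR: "e \<in> carrier R" using L1.Icarr[OF e(1)] .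
      have eU: "e \<notin> Units R"
      proof
        assume U: "e \<in> Units R"
        have "\<one> \<in> L1" using L1.I_l_closed[OF e(1), of "inv e"] U by simp
        then have "L1 = carrier R" by (rule L1.one_imp_carrier)
        moreover have "L0 \<subseteq> carrier R" using ideal.Icarr[OF coset_chainD(2)[OF K K0]] by (rule subsetI)
        ultimately show False using K1(2) by simp
      qed
      obtain u where u: "u \<in> Q L2" "s = u \<otimes> e" using QE[OF K2(1) eR e(2)] by blast
      have uR: "u \<in> carrier R" using u by (simp add: Q_def)
      define q where "q = \<one> \<ominus> a2 \<otimes> b"
      have q: "q \<in> Units R" unfolding q_def using one_minus_mult_nonunit b(1) bU a2 by blast
      have qR: "q \<in> carrier R" by (rule Units_closed[OF q])
      have "u \<odot>\<^bsub>E\<^esub> y = (b \<otimes> u) \<odot>\<^bsub>E\<^esub> z"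
        using b z(1) uR by (simp add: E.smult_assoc1[symmetric] m_comm)
      also have "\<dots> = b \<odot>\<^bsub>E\<^esub> ((u \<otimes> a2) \<odot>\<^bsub>E\<^esub> y)"
        using z_eq[OF K2(1) u(1)] b(1) uR z(1) by (simp add: E.smult_assoc1)
      also have "\<dots> = (b \<otimes> (u \<otimes> a2)) \<odot>\<^bsub>E\<^esub> y"
        using b(1) uR y(1) a2 by (simp add: E.smult_assoc1)
      finally have eq: "u \<odot>\<^bsub>E\<^esub> y = (b \<otimes> (u \<otimes> a2)) \<odot>\<^bsub>E\<^esub> y" .
      have "u = q \<otimes> u \<oplus> b \<otimes> (u \<otimes> a2)" unfolding q_def using uR b(1) a2 by algebra
      then have "u \<odot>\<^bsub>E\<^esub> y = (q \<otimes> u \<oplus> b \<otimes> (u \<otimes> a2)) \<odot>\<^bsub>E\<^esub> y" by simp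
      also have "\<dots> = (q \<otimes> u) \<odot>\<^bsub>E\<^esub> y \<oplus>\<^bsub>E\<^esub> u \<odot>\<^bsub>E\<^esub> y"
        using qR uR b(1) a2 y(1) by (simp add: E.smult_l_distr eq)
      finally have "(q \<otimes> u) \<odot>\<^bsub>E\<^esub> y = \<zero>\<^bsub>E\<^esub>" using qR uR y(1) by simp
      then obtain v where v: "v \<in> carrier R" "q \<otimes> u = v \<otimes> s" using y(2)[of "q \<otimes> u"] qR uR by auto
      have "u = inv q \<otimes> (q \<otimes> u)" using q qR uR by (simp add: m_assoc[symmetric])
      also have "\<dots> = (inv q \<otimes> v) \<otimes> e \<otimes> u"
        unfolding v(2) u(2) using q v(1) uR eR by (simp add: m_ac)
      finally have "u = \<zero>"
        by (intro nonunit_mult_fixed_zero[OF eR eU _ uR, of "inv q \<otimes> v"]) (use q v in auto)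
      with u eR s(2) show False by simp
    qed
    then obtain c where c: "c \<in> carrier R" "z = c \<odot>\<^bsub>E\<^esub> y" by blast
    \<comment> \<open>From \<open>z = c y\<close>, \<open>Q M'\<close> times \<open>c - b'\<close>
      falls into \<open>R s\<close>. This places \<open>c - b'\<close> in the strictly larger ideal
      \<open>M\<close>, and \<open>b' - b\<close> lies in \<open>M\<close> as well.\<close>
    have "c \<ominus> b \<in> M" if bM: "(b, M) \<in> K" for b M
    proof -
      from smaller[OF bM] obtain b' M' where b'M': "(b', M') \<in> K" "\<not> M \<subseteq> M'" by (elim exE conjE)
      note bR = coset_chainD(1)[OF K bM] and b'R = coset_chainD(1)[OF K b'M'(1)]
      interpret M: ideal M R using coset_chainD(2)[OF K bM] .
      define d where "d = c \<ominus> b'"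
      have dR: "d \<in> carrier R" using c b'R by (simp add: d_def)
      have "d \<in> M"
      proof (rule ccontr)
        assume dM: "d \<notin> M"
        \<comment> \<open>The element \<open>e\<close> witnesses the slack: \<open>d\<close> outside
          \<open>M\<close> gives \<open>e = t d\<close> with a nonunit \<open>t\<close>, and
          \<open>s = u e\<close> then turns \<open>u d = v s\<close> into
          \<open>u d = v t (u d)\<close>.\<close>
        obtain e where e: "e \<in> M" "e \<notin> M'" using b'M'(2) by (meson subsetI)
        have eR: "e \<in> carrier R" using M.Icarr[OF e(1)] .
        have "\<not> (\<exists>t\<in>carrier R. d = t \<otimes> e)" using dM M.I_l_closed[OF e(1)] by auto
        then obtain t where t: "t \<in> carrier R" "t \<notin> Units R" "e = t \<otimes> d"
          using not_multiple_nonunitE[OF dR eR] by blast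
        obtain u where u: "u \<in> Q M'" "s = u \<otimes> e" using QE[OF b'M'(1) eR e(2)] by blast
        have uR: "u \<in> carrier R" using u by (simp add: Q_def)
        have "(u \<otimes> b') \<odot>\<^bsub>E\<^esub> y = (u \<otimes> c) \<odot>\<^bsub>E\<^esub> y"
          using z_eq[OF b'M'(1) u(1)] c uR y(1) by (simp add: E.smult_assoc1)
        moreover have "u \<otimes> c = u \<otimes> d \<oplus> u \<otimes> b'" unfolding d_def using uR c(1) b'R by algebra
        ultimately have "(u \<otimes> b') \<odot>\<^bsub>E\<^esub> y = (u \<otimes> d) \<odot>\<^bsub>E\<^esub> y \<oplus>\<^bsub>E\<^esub> (u \<otimes> b') \<odot>\<^bsub>E\<^esub> y"
          using uR dR b'R y(1) by (simp add: E.smult_l_distr)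
        then have "(u \<otimes> d) \<odot>\<^bsub>E\<^esub> y = \<zero>\<^bsub>E\<^esub>" using uR dR b'R y(1) by simp
        then obtain v where v: "v \<in> carrier R" "u \<otimes> d = v \<otimes> s" using y(2)[of "u \<otimes> d"] uR dR by auto
        have "v \<otimes> s = v \<otimes> t \<otimes> (u \<otimes> d)"
          unfolding u(2) t(3) using v(1) t(1) uR dR by algebra
        then have "u \<otimes> d = v \<otimes> t \<otimes> (u \<otimes> d)" using v(2) by simp
        then have "u \<otimes> d = \<zero>"
          using nonunit_mult_fixed_zero[OF t(1,2) v(1), of "u \<otimes> d"] uR dR by simp
        moreover have "s = t \<otimes> (u \<otimes> d)" unfolding u(2) t(3) using t(1) uR dR by algebra
        ultimately show False using t(1) s(2) by simp
      qed
      moreover have "b' \<ominus> b \<in> M" using coset_chain_strictD[OF K bM b'M'] .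
      ultimately have "d \<oplus> (b' \<ominus> b) \<in> M" by (rule M.a_closed)
      moreover have "d \<oplus> (b' \<ominus> b) = c \<ominus> b" unfolding d_def using c(1) bR b'R by algebra
      ultimately show ?thesis by simp
    qed
    with c show ?thesis by blast
  qed
qed

section \<open>From almost maximality to a uniserial module\<close>

text \<open>The coefficient \<open>a\<close> is found by solving the chain of all conditions
  \<open>d y = d a x\<close>. The inclusion of annihilators ensures that each \<open>d\<close> with
  \<open>d y\<close> in \<open>R x\<close> contributes a solvable condition; essentiality of
  \<open>R g\<close> forces \<open>y - a x = 0\<close>.\<close>

lemma almost_maximal_imp_multiple:
  assumes am: "almost_maximal R" and E: "module R E"
    and g: "g \<in> carrier E"
      "\<And>a. a \<in> carrier R \<Longrightarrow> a \<odot>\<^bsub>E\<^esub> g = \<zero>\<^bsub>E\<^esub> \<longleftrightarrow> (\<exists>c\<in>carrier R. a = c \<otimes> r)"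
    and r: "r \<in> carrier R" "r \<noteq> \<zero>"
    and ess: "\<And>x. x \<in> carrier E \<Longrightarrow> x \<noteq> \<zero>\<^bsub>E\<^esub> \<Longrightarrow>
      \<exists>c\<in>carrier R. \<exists>u\<in>carrier R. c \<odot>\<^bsub>E\<^esub> x = u \<odot>\<^bsub>E\<^esub> g \<and> c \<odot>\<^bsub>E\<^esub> x \<noteq> \<zero>\<^bsub>E\<^esub>"
    and x: "x \<in> carrier E" and y: "y \<in> carrier E"
    and ann: "\<And>a. a \<in> carrier R \<Longrightarrow> a \<odot>\<^bsub>E\<^esub> x = \<zero>\<^bsub>E\<^esub> \<Longrightarrow> a \<odot>\<^bsub>E\<^esub> y = \<zero>\<^bsub>E\<^esub>"
  shows "\<exists>a\<in>carrier R. y = a \<odot>\<^bsub>E\<^esub> x"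
proof (cases "x = \<zero>\<^bsub>E\<^esub>")
  case True
  interpret E: module R E by (rule E)
  have "y = \<zero>\<^bsub>E\<^esub>" using True ann[OF one_closed] x y by simp
  with True y show ?thesis by (intro bexI[of _ \<one>]) simp_all
next
  case x0: False
  interpret E: module R E by (rule E)
  have socle: "\<exists>q\<in>carrier R. r = q \<otimes> u" if "u \<in> carrier R" "u \<odot>\<^bsub>E\<^esub> g \<noteq> \<zero>\<^bsub>E\<^esub>" for u
    using divides_linear[OF \<open>u \<in> carrier R\<close> r(1)] g(2)[OF \<open>u \<in> carrier R\<close>] \<open>u \<odot>\<^bsub>E\<^esub> g \<noteq> \<zero>\<^bsub>E\<^esub>\<close> by blast
  have rg: "r \<odot>\<^bsub>E\<^esub> g = \<zero>\<^bsub>E\<^esub>" using g(2)[OF r(1)] r(1) by (auto intro!: bexI[of _ \<one>])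
  \<comment> \<open>Multiplication by a nonunit is not injective on any nonzero cyclic submodule.\<close>
  have kill: "\<exists>c\<in>carrier R. (c \<otimes> p) \<odot>\<^bsub>E\<^esub> w = \<zero>\<^bsub>E\<^esub> \<and> c \<odot>\<^bsub>E\<^esub> w \<noteq> \<zero>\<^bsub>E\<^esub>"
    if w: "w \<in> carrier E" "w \<noteq> \<zero>\<^bsub>E\<^esub>" and p: "p \<in> carrier R" "p \<notin> Units R" for w p
  proof -
    obtain c u where c: "c \<in> carrier R" and u: "u \<in> carrier R"
      and eq: "c \<odot>\<^bsub>E\<^esub> w = u \<odot>\<^bsub>E\<^esub> g" and ne: "c \<odot>\<^bsub>E\<^esub> w \<noteq> \<zero>\<^bsub>E\<^esub>" using ess[OF w] by blast
    obtain q where q: "q \<in> carrier R" "r = q \<otimes> u" using socle[OF u] ne eq by auto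
    have scale: "(a \<otimes> c) \<odot>\<^bsub>E\<^esub> w = (a \<otimes> u) \<odot>\<^bsub>E\<^esub> g" if a: "a \<in> carrier R" for a
      using a c u w(1) g(1) eq by (simp add: E.smult_assoc1)
    \<comment> \<open>The element \<open>c w = u g\<close> is killed by \<open>q\<close>. If
      \<open>q = t p\<close>, then \<open>t c w\<close> is killed by \<open>p\<close> and is
      nonzero, as otherwise \<open>r\<close> would be a nonunit multiple of itself. If
      \<open>q\<close> divides \<open>p\<close>, then \<open>c\<close> itself serves.\<close>
    from divides_linear[OF p(1) q(1)] show ?thesis
    proof
      assume "\<exists>t\<in>carrier R. q = t \<otimes> p"
      then obtain t where t: "t \<in> carrier R" "q = t \<otimes> p" by blast
      have "(t \<otimes> c \<otimes> p) \<odot>\<^bsub>E\<^esub> w = (q \<otimes> c) \<odot>\<^bsub>E\<^esub> w"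
        unfolding t(2) using t(1) c p(1) by (simp add: m_ac)
      also have "\<dots> = \<zero>\<^bsub>E\<^esub>" using scale[OF q(1)] rg q(2) by simp
      finally have 1: "(t \<otimes> c \<otimes> p) \<odot>\<^bsub>E\<^esub> w = \<zero>\<^bsub>E\<^esub>" .
      have "(t \<otimes> c) \<odot>\<^bsub>E\<^esub> w \<noteq> \<zero>\<^bsub>E\<^esub>"
      proof
        assume "(t \<otimes> c) \<odot>\<^bsub>E\<^esub> w = \<zero>\<^bsub>E\<^esub>"
        then have "(t \<otimes> u) \<odot>\<^bsub>E\<^esub> g = \<zero>\<^bsub>E\<^esub>" using scale[OF t(1)] by simp
        then obtain v where v: "v \<in> carrier R" "t \<otimes> u = v \<otimes> r" using g(2)[of "t \<otimes> u"] t(1) u by auto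
        have "r = p \<otimes> (t \<otimes> u)" unfolding q(2) t(2) using t(1) p(1) u by algebra
        also have "\<dots> = v \<otimes> p \<otimes> r" unfolding v(2) using v(1) p(1) r(1) by algebra
        finally show False using nonunit_mult_fixed_zero[OF p v(1) r(1)] r(2) by simp
      qed
      with 1 t(1) c show ?thesis by (intro bexI[of _ "t \<otimes> c"]) simp_all
    next
      assume "\<exists>t\<in>carrier R. p = t \<otimes> q"
      then obtain t where t: "t \<in> carrier R" "p = t \<otimes> q" by blast
      have "(c \<otimes> p) \<odot>\<^bsub>E\<^esub> w = (p \<otimes> u) \<odot>\<^bsub>E\<^esub> g" using scale[OF p(1)] c p(1) by (simp add: m_comm)
      also have "\<dots> = (t \<otimes> r) \<odot>\<^bsub>E\<^esub> g" unfolding t(2) q(2) using t(1) q(1) u by (simp add: m_assoc)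
      also have "\<dots> = \<zero>\<^bsub>E\<^esub>" using t(1) r(1) g(1) rg by (simp add: E.smult_assoc1)
      finally show ?thesis using c ne by blast
    qed
  qed
  \<comment> \<open>If \<open>d\<close> does not divide \<open>a\<close>, then
    \<open>d = p a\<close> with a nonunit \<open>p\<close>, and \<open>d y = 0\<close>, so
    \<open>a' = 0\<close> works. Indeed \<open>kill\<close> would otherwise give \<open>c\<close>
    with \<open>c p d y = 0\<close> and \<open>c d y\<close> nonzero, although
    \<open>c d x = c p a x = c p d y = 0\<close>.\<close>
  have lift: "\<exists>a'\<in>carrier R. d \<odot>\<^bsub>E\<^esub> y = (d \<otimes> a') \<odot>\<^bsub>E\<^esub> x"
    if d: "d \<in> carrier R" and a: "a \<in> carrier R" and eq: "d \<odot>\<^bsub>E\<^esub> y = a \<odot>\<^bsub>E\<^esub> x" for d a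
  proof (cases "\<exists>a'\<in>carrier R. a = a' \<otimes> d")
    case True
    then obtain a' where "a' \<in> carrier R" "a = a' \<otimes> d" by blast
    with eq d show ?thesis by (intro bexI[of _ a']) (simp_all add: m_comm)
  next
    case False
    then obtain p where p: "p \<in> carrier R" "p \<notin> Units R" "d = p \<otimes> a"
      using not_multiple_nonunitE[OF a d] by blast
    have "d \<odot>\<^bsub>E\<^esub> y = \<zero>\<^bsub>E\<^esub>"
    proof (rule ccontr)
      assume "d \<odot>\<^bsub>E\<^esub> y \<noteq> \<zero>\<^bsub>E\<^esub>"
      then obtain c where c: "c \<in> carrier R" "(c \<otimes> p) \<odot>\<^bsub>E\<^esub> (d \<odot>\<^bsub>E\<^esub> y) = \<zero>\<^bsub>E\<^esub>"
        "c \<odot>\<^bsub>E\<^esub> (d \<odot>\<^bsub>E\<^esub> y) \<noteq> \<zero>\<^bsub>E\<^esub>"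
        using kill[OF E.smult_closed[OF d y] _ p(1,2)] by blast
      have "(c \<otimes> d) \<odot>\<^bsub>E\<^esub> x = (c \<otimes> p) \<odot>\<^bsub>E\<^esub> (a \<odot>\<^bsub>E\<^esub> x)"
        unfolding p(3) using c(1) p(1) a x by (simp add: E.smult_assoc1[symmetric] m_assoc)
      also have "\<dots> = \<zero>\<^bsub>E\<^esub>" using c(2) eq by simp
      finally have "(c \<otimes> d) \<odot>\<^bsub>E\<^esub> y = \<zero>\<^bsub>E\<^esub>" using ann c(1) d by simp
      with c(1,3) d y show False by (simp add: E.smult_assoc1)
    qed
    with d x show ?thesis by (intro bexI[of _ \<zero>]) simp_all
  qed
  \<comment> \<open>For fixed \<open>d\<close> the solutions form one coset of the annihilator of
    \<open>d x\<close>; it enters with each of its representatives.\<close>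
  define K where "K = {(a, {l \<in> carrier R. (d \<otimes> l) \<odot>\<^bsub>E\<^esub> x = \<zero>\<^bsub>E\<^esub>}) |a d.
    a \<in> carrier R \<and> d \<in> carrier R \<and> d \<odot>\<^bsub>E\<^esub> y = (d \<otimes> a) \<odot>\<^bsub>E\<^esub> x}"
  have smult_diff: "(d \<otimes> (a \<ominus> b)) \<odot>\<^bsub>E\<^esub> x = \<zero>\<^bsub>E\<^esub> \<longleftrightarrow> (d \<otimes> a) \<odot>\<^bsub>E\<^esub> x = (d \<otimes> b) \<odot>\<^bsub>E\<^esub> x"
    if "d \<in> carrier R" "a \<in> carrier R" "b \<in> carrier R" for a b d
  proof -
    have "d \<otimes> a = d \<otimes> (a \<ominus> b) \<oplus> d \<otimes> b" using that by algebra
    then have "(d \<otimes> a) \<odot>\<^bsub>E\<^esub> x = (d \<otimes> (a \<ominus> b)) \<odot>\<^bsub>E\<^esub> x \<oplus>\<^bsub>E\<^esub> (d \<otimes> b) \<odot>\<^bsub>E\<^esub> x"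
      using that x by (simp add: E.smult_l_distr)
    then show ?thesis using that x by simp
  qed
  have "coset_chain K"
  proof (rule coset_chainI)
    fix a L assume "(a, L) \<in> K"
    then obtain d where d: "d \<in> carrier R" "a \<in> carrier R" "L = {l \<in> carrier R. (d \<otimes> l) \<odot>\<^bsub>E\<^esub> x = \<zero>\<^bsub>E\<^esub>}"
      unfolding K_def by blast
    have "ideal L R"
    proof (rule idealI[OF ring_axioms])
      show "subgroup L (add_monoid R)"
      proof (rule add.subgroupI)
        show "L \<noteq> {}" using d x by (auto intro!: exI[of _ \<zero>])
        show "\<ominus> l \<in> L" if "l \<in> L" for l
          using that d(1) x unfolding d(3) by (simp add: r_minus E.smult_l_minus)
        show "l \<oplus> l' \<in> L" if "l \<in> L" "l' \<in> L" for l l'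
          using that d(1) x unfolding d(3) by (simp add: r_distr E.smult_l_distr)
      qed (auto simp: d(3))
    next
      fix l b assume l: "l \<in> L" and b: "b \<in> carrier R"
      have "(d \<otimes> (b \<otimes> l)) \<odot>\<^bsub>E\<^esub> x = (b \<otimes> (d \<otimes> l)) \<odot>\<^bsub>E\<^esub> x"
        using l b d(1) unfolding d(3) by (simp add: m_lcomm)
      also have "\<dots> = \<zero>\<^bsub>E\<^esub>" using l b d(1) x unfolding d(3) by (simp add: E.smult_assoc1[of b])
      finally show "b \<otimes> l \<in> L" using l b unfolding d(3) by simp
      then show "l \<otimes> b \<in> L" using l b unfolding d(3) by (simp add: m_comm)
    qed
    with d(2) show "a \<in> carrier R \<and> ideal L R" by blast
  next
    \<comment> \<open>Replacing \<open>d\<close> by a multiple \<open>t d\<close> weakens the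
      condition, so linearity of divisibility among the \<open>d\<close> orders the cosets.\<close>
    have step: "L \<subseteq> M \<and> a \<ominus> b \<in> M"
      if a: "a \<in> carrier R" and d: "d \<in> carrier R" "d \<odot>\<^bsub>E\<^esub> y = (d \<otimes> a) \<odot>\<^bsub>E\<^esub> x"
        and L: "L = {l \<in> carrier R. (d \<otimes> l) \<odot>\<^bsub>E\<^esub> x = \<zero>\<^bsub>E\<^esub>}"
        and b: "b \<in> carrier R" and e: "e \<in> carrier R" "e \<odot>\<^bsub>E\<^esub> y = (e \<otimes> b) \<odot>\<^bsub>E\<^esub> x"
        and M: "M = {l \<in> carrier R. (e \<otimes> l) \<odot>\<^bsub>E\<^esub> x = \<zero>\<^bsub>E\<^esub>}"
        and t: "t \<in> carrier R" "e = t \<otimes> d" for a b d e L M t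
    proof
      have et: "(e \<otimes> l) \<odot>\<^bsub>E\<^esub> x = t \<odot>\<^bsub>E\<^esub> ((d \<otimes> l) \<odot>\<^bsub>E\<^esub> x)" if "l \<in> carrier R" for l
        using that t(1) d(1) x by (simp add: t(2) E.smult_assoc1[symmetric] m_assoc)
      show "L \<subseteq> M"
      proof
        fix l assume "l \<in> L"
        then have "l \<in> carrier R" "(d \<otimes> l) \<odot>\<^bsub>E\<^esub> x = \<zero>\<^bsub>E\<^esub>" unfolding L by blast+
        with et[of l] t(1) show "l \<in> M" unfolding M by simp
      qed
      have "(e \<otimes> a) \<odot>\<^bsub>E\<^esub> x = t \<odot>\<^bsub>E\<^esub> (d \<odot>\<^bsub>E\<^esub> y)" using et[OF a] d(2) by simp
      also have "\<dots> = e \<odot>\<^bsub>E\<^esub> y" using t(1) d(1) y by (simp add: t(2) E.smult_assoc1)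
      finally have "(e \<otimes> a) \<odot>\<^bsub>E\<^esub> x = (e \<otimes> b) \<odot>\<^bsub>E\<^esub> x" using e(2) by simp
      then show "a \<ominus> b \<in> M" using smult_diff[OF e(1) a b] a b unfolding M by simp
    qed
    fix a L b M assume "(a, L) \<in> K" "(b, M) \<in> K"
    then obtain d e where
      a: "a \<in> carrier R" and d: "d \<in> carrier R" "d \<odot>\<^bsub>E\<^esub> y = (d \<otimes> a) \<odot>\<^bsub>E\<^esub> x"
        and L: "L = {l \<in> carrier R. (d \<otimes> l) \<odot>\<^bsub>E\<^esub> x = \<zero>\<^bsub>E\<^esub>}"
        and b: "b \<in> carrier R" and e: "e \<in> carrier R" "e \<odot>\<^bsub>E\<^esub> y = (e \<otimes> b) \<odot>\<^bsub>E\<^esub> x"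
        and M: "M = {l \<in> carrier R. (e \<otimes> l) \<odot>\<^bsub>E\<^esub> x = \<zero>\<^bsub>E\<^esub>}"
      unfolding K_def by blast
    from divides_linear[OF d(1) e(1)] show "L \<subseteq> M \<and> a \<ominus> b \<in> M \<or> M \<subseteq> L \<and> b \<ominus> a \<in> L"
    proof
      assume "\<exists>t\<in>carrier R. e = t \<otimes> d"
      with step[OF a d L b e M] show ?thesis by blast
    next
      assume "\<exists>t\<in>carrier R. d = t \<otimes> e"
      with step[OF b e M a d L] show ?thesis by blast
    qed
  qed
  have "\<exists>c\<in>carrier R. \<forall>(a, L)\<in>K. c \<ominus> a \<in> L"
  \<comment> \<open>A nonzero annihilator of \<open>x\<close> lies in every ideal of
    \<open>K\<close>. If there is none, then \<open>c x = u g\<close> and \<open>r = q u\<close>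
    give \<open>q c x = 0\<close>, hence \<open>q c = 0\<close> with both factors nonzero.\<close>
  proof (cases "\<exists>s\<in>carrier R. s \<noteq> \<zero> \<and> s \<odot>\<^bsub>E\<^esub> x = \<zero>\<^bsub>E\<^esub>")
    case True
    then obtain s where s: "s \<in> carrier R" "s \<noteq> \<zero>" "s \<odot>\<^bsub>E\<^esub> x = \<zero>\<^bsub>E\<^esub>" by blast
    have sL: "s \<in> L" if "(a, L) \<in> K" for a L
    proof -
      obtain d where d: "d \<in> carrier R" "L = {l \<in> carrier R. (d \<otimes> l) \<odot>\<^bsub>E\<^esub> x = \<zero>\<^bsub>E\<^esub>}"
        using \<open>(a, L) \<in> K\<close> unfolding K_def by blast
      show ?thesis using d(1) s(1,3) x unfolding d(2) by (simp add: E.smult_assoc1)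
    qed
    show ?thesis
    proof (rule almost_maximal_solve[OF am \<open>coset_chain K\<close> s(1,2) sL])
      fix c assume "c \<in> carrier R" "\<And>a L. (a, L) \<in> K \<Longrightarrow> c \<ominus> a \<in> L"
      then show ?thesis by blast
    qed
  next
    case False
    obtain c u where c: "c \<in> carrier R" and u: "u \<in> carrier R"
      and eq: "c \<odot>\<^bsub>E\<^esub> x = u \<odot>\<^bsub>E\<^esub> g" and ne: "c \<odot>\<^bsub>E\<^esub> x \<noteq> \<zero>\<^bsub>E\<^esub>" using ess[OF x x0] by blast
    obtain q where q: "q \<in> carrier R" "r = q \<otimes> u" using socle[OF u] ne eq by auto
    have "(q \<otimes> c) \<odot>\<^bsub>E\<^esub> x = (q \<otimes> u) \<odot>\<^bsub>E\<^esub> g"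
      using q(1) c u x g(1) eq by (simp add: E.smult_assoc1)
    then have "(q \<otimes> c) \<odot>\<^bsub>E\<^esub> x = \<zero>\<^bsub>E\<^esub>" using rg q(2) by simp
    then have qc: "q \<otimes> c = \<zero>" using False q(1) c by blast
    have q0: "q \<noteq> \<zero>" using q(2) r(2) l_null[OF u] by metis
    have c0: "c \<noteq> \<zero>" using ne E.smult_l_null[OF x] by metis
    show ?thesis
    proof (rule almost_maximal_solve_zero_divisors[OF am \<open>coset_chain K\<close> q(1) c q0 c0 qc])
      fix c assume "c \<in> carrier R" "\<And>a L. (a, L) \<in> K \<Longrightarrow> c \<ominus> a \<in> L"
      then show ?thesis by blast
    qed
  qed
  then obtain a where a: "a \<in> carrier R" and sol: "\<And>b L. (b, L) \<in> K \<Longrightarrow> a \<ominus> b \<in> L" by blast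
  \<comment> \<open>\<open>lift\<close> provides a member of \<open>K\<close> for each
    \<open>d\<close> carrying \<open>y\<close> into \<open>R x\<close>, so the common solution
    serves all of them.\<close>
  have a_sol: "d \<odot>\<^bsub>E\<^esub> y = (d \<otimes> a) \<odot>\<^bsub>E\<^esub> x"
    if d: "d \<in> carrier R" and b: "b \<in> carrier R" "d \<odot>\<^bsub>E\<^esub> y = b \<odot>\<^bsub>E\<^esub> x" for d b
  proof -
    obtain a' where a': "a' \<in> carrier R" "d \<odot>\<^bsub>E\<^esub> y = (d \<otimes> a') \<odot>\<^bsub>E\<^esub> x" using lift[OF d b] by blast
    then have "(a', {l \<in> carrier R. (d \<otimes> l) \<odot>\<^bsub>E\<^esub> x = \<zero>\<^bsub>E\<^esub>}) \<in> K" using d unfolding K_def by blast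
    then have "(d \<otimes> (a \<ominus> a')) \<odot>\<^bsub>E\<^esub> x = \<zero>\<^bsub>E\<^esub>" using sol by blast
    with smult_diff[OF d a a'(1)] a'(2) show ?thesis by simp
  qed
  define z where "z = y \<oplus>\<^bsub>E\<^esub> \<ominus>\<^bsub>E\<^esub> (a \<odot>\<^bsub>E\<^esub> x)"
  have ax: "a \<odot>\<^bsub>E\<^esub> x \<in> carrier E" using a x by simp
  have z: "z \<in> carrier E" using y ax by (simp add: z_def)
  have y_eq: "y = z \<oplus>\<^bsub>E\<^esub> a \<odot>\<^bsub>E\<^esub> x" using y ax by (simp add: z_def E.M.a_assoc E.M.l_neg)
  have Rz_Rx: "d \<odot>\<^bsub>E\<^esub> z = \<zero>\<^bsub>E\<^esub>" if d: "d \<in> carrier R" and b: "b \<in> carrier R" "d \<odot>\<^bsub>E\<^esub> z = b \<odot>\<^bsub>E\<^esub> x" for d b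
  proof -
    have dy: "d \<odot>\<^bsub>E\<^esub> y = d \<odot>\<^bsub>E\<^esub> z \<oplus>\<^bsub>E\<^esub> (d \<otimes> a) \<odot>\<^bsub>E\<^esub> x"
      using d z a x by (subst y_eq) (simp add: E.smult_r_distr E.smult_assoc1)
    also have "\<dots> = (b \<oplus> d \<otimes> a) \<odot>\<^bsub>E\<^esub> x" using b d a x by (simp add: E.smult_l_distr)
    finally have "d \<odot>\<^bsub>E\<^esub> y = (b \<oplus> d \<otimes> a) \<odot>\<^bsub>E\<^esub> x" .
    then have "d \<odot>\<^bsub>E\<^esub> y = (d \<otimes> a) \<odot>\<^bsub>E\<^esub> x" by (rule a_sol[OF d, rotated]) (use d b(1) a in simp)
    with dy show ?thesis using d z a x by simp
  qed
  have "z = \<zero>\<^bsub>E\<^esub>"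
  proof (rule ccontr)
    assume z0: "z \<noteq> \<zero>\<^bsub>E\<^esub>"
    obtain c u where c: "c \<in> carrier R" and u: "u \<in> carrier R"
      and cz: "c \<odot>\<^bsub>E\<^esub> z = u \<odot>\<^bsub>E\<^esub> g" "c \<odot>\<^bsub>E\<^esub> z \<noteq> \<zero>\<^bsub>E\<^esub>" using ess[OF z z0] by blast
    obtain d v where d: "d \<in> carrier R" and v: "v \<in> carrier R"
      and dx: "d \<odot>\<^bsub>E\<^esub> x = v \<odot>\<^bsub>E\<^esub> g" "d \<odot>\<^bsub>E\<^esub> x \<noteq> \<zero>\<^bsub>E\<^esub>" using ess[OF x x0] by blast
    \<comment> \<open>Nonzero multiples of \<open>z\<close> and \<open>x\<close> both lie in
      \<open>R g\<close>; comparing their coefficients yields a nonzero element of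
      \<open>R z\<close> inside \<open>R x\<close>, against \<open>Rz_Rx\<close>.\<close>
    from divides_linear[OF u v] show False
    proof
      assume "\<exists>t\<in>carrier R. v = t \<otimes> u"
      then obtain t where t: "t \<in> carrier R" "v = t \<otimes> u" by blast
      have tcz: "(t \<otimes> c) \<odot>\<^bsub>E\<^esub> z = d \<odot>\<^bsub>E\<^esub> x"
        using t c u z g(1) cz(1) dx(1) by (simp add: E.smult_assoc1)
      with Rz_Rx[of "t \<otimes> c" d] t(1) c d dx(2) show False by simp
    next
      assume "\<exists>t\<in>carrier R. u = t \<otimes> v"
      then obtain t where t: "t \<in> carrier R" "u = t \<otimes> v" by blast
      have "c \<odot>\<^bsub>E\<^esub> z = (t \<otimes> d) \<odot>\<^bsub>E\<^esub> x"
        using t d v x g(1) cz(1) dx(1) by (simp add: E.smult_assoc1)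
      with Rz_Rx[OF c, of "t \<otimes> d"] t(1) d cz(2) show False by simp
    qed
  qed
  with y_eq ax a show ?thesis by auto
qed

text \<open>Annihilators of two elements are comparable, and the element with the smaller
  annihilator generates the other.\<close>

lemma almost_maximal_imp_uniserial:
  assumes am: "almost_maximal R" and E: "module R E"
    and g: "g \<in> carrier E"
      "\<And>a. a \<in> carrier R \<Longrightarrow> a \<odot>\<^bsub>E\<^esub> g = \<zero>\<^bsub>E\<^esub> \<longleftrightarrow> (\<exists>c\<in>carrier R. a = c \<otimes> r)"
    and r: "r \<in> carrier R" "r \<noteq> \<zero>"
    and ess: "\<And>x. x \<in> carrier E \<Longrightarrow> x \<noteq> \<zero>\<^bsub>E\<^esub> \<Longrightarrow>
      \<exists>c\<in>carrier R. \<exists>u\<in>carrier R. c \<odot>\<^bsub>E\<^esub> x = u \<odot>\<^bsub>E\<^esub> g \<and> c \<odot>\<^bsub>E\<^esub> x \<noteq> \<zero>\<^bsub>E\<^esub>"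
  shows "uniserial R E"
proof -
  interpret E: module R E by (rule E)
  have chain: "(\<forall>a\<in>carrier R. a \<odot>\<^bsub>E\<^esub> x = \<zero>\<^bsub>E\<^esub> \<longrightarrow> a \<odot>\<^bsub>E\<^esub> y = \<zero>\<^bsub>E\<^esub>) \<or>
      (\<forall>a\<in>carrier R. a \<odot>\<^bsub>E\<^esub> y = \<zero>\<^bsub>E\<^esub> \<longrightarrow> a \<odot>\<^bsub>E\<^esub> x = \<zero>\<^bsub>E\<^esub>)"
    if xy: "x \<in> carrier E" "y \<in> carrier E" for x y
  proof (rule ccontr)
    assume "\<not> ?thesis"
    then obtain a b where ab: "a \<in> carrier R" "b \<in> carrier R" "a \<odot>\<^bsub>E\<^esub> x = \<zero>\<^bsub>E\<^esub>" "a \<odot>\<^bsub>E\<^esub> y \<noteq> \<zero>\<^bsub>E\<^esub>"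
      "b \<odot>\<^bsub>E\<^esub> y = \<zero>\<^bsub>E\<^esub>" "b \<odot>\<^bsub>E\<^esub> x \<noteq> \<zero>\<^bsub>E\<^esub>" by blast
    from divides_linear[OF ab(1,2)] show False
      using ab xy by (auto simp: E.smult_assoc1)
  qed
  show ?thesis
    unfolding E.uniserial_iff_cyclic
  proof (intro ballI)
    fix x y assume xy: "x \<in> carrier E" "y \<in> carrier E"
    from chain[OF xy] show "(\<exists>a\<in>carrier R. y = a \<odot>\<^bsub>E\<^esub> x) \<or> (\<exists>a\<in>carrier R. x = a \<odot>\<^bsub>E\<^esub> y)"
    proof
      assume "\<forall>a\<in>carrier R. a \<odot>\<^bsub>E\<^esub> x = \<zero>\<^bsub>E\<^esub> \<longrightarrow> a \<odot>\<^bsub>E\<^esub> y = \<zero>\<^bsub>E\<^esub>"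
      then have "\<exists>a\<in>carrier R. y = a \<odot>\<^bsub>E\<^esub> x"
        by (intro almost_maximal_imp_multiple[OF am E g r ess xy]) auto
      then show ?thesis ..
    next
      assume "\<forall>a\<in>carrier R. a \<odot>\<^bsub>E\<^esub> y = \<zero>\<^bsub>E\<^esub> \<longrightarrow> a \<odot>\<^bsub>E\<^esub> x = \<zero>\<^bsub>E\<^esub>"
      then have "\<exists>a\<in>carrier R. x = a \<odot>\<^bsub>E\<^esub> y"
        by (intro almost_maximal_imp_multiple[OF am E g r ess xy(2,1)]) auto
      then show ?thesis ..
    qed
  qed
qed

section \<open>The injective hull of a cyclic quotient\<close>

text \<open>The generator is the image of the coset of one: injectivity of \<open>j\<close> gives
  its annihilator, and essentiality is applied to cyclic submodules. Together with injectivity of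
  \<open>E\<close>, these properties are all that the two implications use of the hull.\<close>

lemma injective_hull_generator:
  assumes r: "r \<in> carrier R" and hull: "injective_hull R (quotient_module R (PIdl r)) E j"
  obtains g where "g \<in> carrier E"
    "\<And>a. a \<in> carrier R \<Longrightarrow> a \<odot>\<^bsub>E\<^esub> g = \<zero>\<^bsub>E\<^esub> \<longleftrightarrow> (\<exists>c\<in>carrier R. a = c \<otimes> r)"
    "\<And>x. x \<in> carrier E \<Longrightarrow> x \<noteq> \<zero>\<^bsub>E\<^esub> \<Longrightarrow>
      \<exists>c\<in>carrier R. \<exists>u\<in>carrier R. c \<odot>\<^bsub>E\<^esub> x = u \<odot>\<^bsub>E\<^esub> g \<and> c \<odot>\<^bsub>E\<^esub> x \<noteq> \<zero>\<^bsub>E\<^esub>"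
proof -
  let ?M = "quotient_module R (PIdl r)"
  interpret E: module R E
    using hull by (simp add: injective_hull_def injective_module_def injective_wrt_def)
  interpret I: ideal "PIdl r" R by (rule cgenideal_ideal[OF r])
  interpret M: module R ?M using quotient_module_module[OF I.ideal_axioms] .
  have j: "j \<in> module_hom R ?M E" and inj: "inj_on j (carrier ?M)"
    and ess: "\<And>N. submodule N R E \<Longrightarrow> N \<noteq> {\<zero>\<^bsub>E\<^esub>} \<Longrightarrow> N \<inter> j ` carrier ?M \<noteq> {\<zero>\<^bsub>E\<^esub>}"
    using hull by (auto simp: injective_hull_def)
  have carr: "carrier ?M = {PIdl r +> a |a. a \<in> carrier R}"
    by (auto simp: quotient_module_def FactRing_def A_RCOSETS_def')
  have zero: "\<zero>\<^bsub>?M\<^esub> = PIdl r"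
    by (simp add: quotient_module_def FactRing_def)
  have smult: "a \<odot>\<^bsub>?M\<^esub> (PIdl r +> \<one>) = PIdl r +> a" if "a \<in> carrier R" for a
    using that by (simp add: quotient_module_def FactRing_def I.rcoset_mult_add)
  have j0: "j \<zero>\<^bsub>?M\<^esub> = \<zero>\<^bsub>E\<^esub>"
  proof -
    have "j (\<zero> \<odot>\<^bsub>?M\<^esub> \<zero>\<^bsub>?M\<^esub>) = \<zero> \<odot>\<^bsub>E\<^esub> j \<zero>\<^bsub>?M\<^esub>" "j \<zero>\<^bsub>?M\<^esub> \<in> carrier E"
      using j M.M.zero_closed zero_closed unfolding module_hom_def by blast+
    then show ?thesis by simp
  qed
  have one: "PIdl r +> \<one> \<in> carrier ?M" unfolding carr by blast
  define g where "g = j (PIdl r +> \<one>)"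
  have jg: "a \<odot>\<^bsub>E\<^esub> g = j (PIdl r +> a)" if a: "a \<in> carrier R" for a
  proof -
    have "j (a \<odot>\<^bsub>?M\<^esub> (PIdl r +> \<one>)) = a \<odot>\<^bsub>E\<^esub> g"
      using j one a unfolding module_hom_def g_def by blast
    then show ?thesis using smult[OF a] by simp
  qed
  show thesis
  proof (rule that)
    show g: "g \<in> carrier E" using j one unfolding module_hom_def g_def by blast
    show "a \<odot>\<^bsub>E\<^esub> g = \<zero>\<^bsub>E\<^esub> \<longleftrightarrow> (\<exists>c\<in>carrier R. a = c \<otimes> r)" if a: "a \<in> carrier R" for a
    proof -
      have mem: "PIdl r +> a \<in> carrier ?M" unfolding carr using a by blast
      have "a \<odot>\<^bsub>E\<^esub> g = \<zero>\<^bsub>E\<^esub> \<longleftrightarrow> j (PIdl r +> a) = j \<zero>\<^bsub>?M\<^esub>" using jg[OF a] j0 by simp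
      also have "\<dots> \<longleftrightarrow> PIdl r +> a = PIdl r"
        using inj_on_eq_iff[OF inj mem M.M.zero_closed] by (simp only: zero)
      also have "\<dots> \<longleftrightarrow> a \<in> PIdl r"
        using I.a_rcos_const[of a] I.a_rcos_self[OF a] by auto
      finally show ?thesis unfolding cgenideal_def by blast
    qed
    fix x assume x: "x \<in> carrier E" "x \<noteq> \<zero>\<^bsub>E\<^esub>"
    define N where "N = {a \<odot>\<^bsub>E\<^esub> x |a. a \<in> carrier R}"
    have N: "submodule N R E" unfolding N_def by (rule E.submodule_cyclic[OF x(1)])
    have xN: "x \<in> N" unfolding N_def using x(1) by (intro CollectI exI[of _ \<one>]) simp
    with x(2) have "N \<noteq> {\<zero>\<^bsub>E\<^esub>}" by blast
    from ess[OF N this] have *: "N \<inter> j ` carrier ?M \<noteq> {\<zero>\<^bsub>E\<^esub>}" .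
    \<comment> \<open>Zero lies in both sets, so an intersection other than {0} contains a nonzero
      \<open>w\<close>.\<close>
    have "\<zero> \<odot>\<^bsub>E\<^esub> x \<in> N" unfolding N_def by blast
    then have "\<zero>\<^bsub>E\<^esub> \<in> N" using x(1) by simp
    moreover have "\<zero>\<^bsub>E\<^esub> \<in> j ` carrier ?M" using imageI[OF M.M.zero_closed, of j] unfolding j0 .
    ultimately obtain w where w: "w \<in> N" "w \<in> j ` carrier ?M" "w \<noteq> \<zero>\<^bsub>E\<^esub>" using * by blast
    obtain c where c: "c \<in> carrier R" "w = c \<odot>\<^bsub>E\<^esub> x" using w(1) unfolding N_def by blast
    obtain u where u: "u \<in> carrier R" "w = j (PIdl r +> u)" using w(2) unfolding carr by blast
    have "w = u \<odot>\<^bsub>E\<^esub> g" using u jg by simp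
    with c u(1) w(3) show "\<exists>c\<in>carrier R. \<exists>u\<in>carrier R. c \<odot>\<^bsub>E\<^esub> x = u \<odot>\<^bsub>E\<^esub> g \<and> c \<odot>\<^bsub>E\<^esub> x \<noteq> \<zero>\<^bsub>E\<^esub>"
      by blast
  qed
qed

end

theorem theorem3p1:
  fixes R :: "('a, 'r) ring_scheme" and P :: "'a set" and r :: 'a
    and F :: "('a, 'b) module" and j :: "'a set \<Rightarrow> 'b"
  assumes "valuation_ring R" and "\<not> field R"
    and "maximalideal P R"
    and "r \<in> P" and "r \<noteq> \<zero>\<^bsub>R\<^esub>"
    and "injective_hull R (quotient_module R (PIdl\<^bsub>R\<^esub> r)) F j"
  shows "almost_maximal R \<longleftrightarrow> uniserial R F"
proof -
  interpret valuation_cring R by (rule valuation_ring_imp_valuation_cring[OF assms(1)])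
  interpret P: maximalideal P R by (rule assms(3))
  have r: "r \<in> carrier R" using P.Icarr[OF assms(4)] .
  have rU: "r \<notin> Units R"
  proof
    assume U: "r \<in> Units R"
    have "\<one>\<^bsub>R\<^esub> \<in> P" using P.I_l_closed[OF assms(4), of "inv\<^bsub>R\<^esub> r"] U by simp
    with P.one_imp_carrier P.I_notcarr show False by simp
  qed
  have inj: "injective_module R F" using assms(6) by (simp add: injective_hull_def)
  then have F: "module R F" by (simp add: injective_module_def injective_wrt_def)
  obtain g where g: "g \<in> carrier F"
    "\<And>a. a \<in> carrier R \<Longrightarrow> a \<odot>\<^bsub>F\<^esub> g = \<zero>\<^bsub>F\<^esub> \<longleftrightarrow> (\<exists>c\<in>carrier R. a = c \<otimes>\<^bsub>R\<^esub> r)"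
    and ess: "\<And>x. x \<in> carrier F \<Longrightarrow> x \<noteq> \<zero>\<^bsub>F\<^esub> \<Longrightarrow>
      \<exists>c\<in>carrier R. \<exists>u\<in>carrier R. c \<odot>\<^bsub>F\<^esub> x = u \<odot>\<^bsub>F\<^esub> g \<and> c \<odot>\<^bsub>F\<^esub> x \<noteq> \<zero>\<^bsub>F\<^esub>"
    using injective_hull_generator[OF r assms(6)] by blast
  show ?thesis
  proof
    show "uniserial R F" if am: "almost_maximal R"
      by (rule almost_maximal_imp_uniserial[OF am F g r assms(5) ess])
    show "almost_maximal R" if uni: "uniserial R F"
      unfolding almost_maximal_iff[OF assms(1)]
    proof (intro allI impI)
      fix K s assume "coset_chain K" "s \<in> carrier R" "s \<noteq> \<zero>\<^bsub>R\<^esub>" "\<forall>(a, L)\<in>K. s \<in> L"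
      then show "\<exists>c\<in>carrier R. \<forall>(a, L)\<in>K. c \<ominus>\<^bsub>R\<^esub> a \<in> L"
        by (intro uniserial_injective_solve[OF inj uni g r assms(5) rU]) auto
    qed
  qed
qed

end
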